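(* Let $\mathscr U$ be an ultrafilter on $\mathbb N$, and let $\{\mathcal C_i\}_{i\in\mathbb N}$ be a sequence of small categories. Then the ultraproduct $\prod_{\mathscr U}\mathcal C_i$ is a well-defined small category whose objects and morphisms are, respectively, $\sim_{\mathscr U}$-equivalence classes of sequences of objects and of morphisms in the $\mathcal C_i$. Moreover, for each of the properties (or structures) of being monoidal, rigid, additive, idempotent-complete, abelian, braided, or symmetric: if the $\mathcal C_i$ have it for $\mathscr U$-almost every $i$, then so does $\prod_{\mathscr U}\mathcal C_i$. If $\mathcal C_i$ is $K_i$-linear for $\mathscr U$-almost every $i$ (with $K_i$ a field), then $\prod_{\mathscr U}\mathcal C_i$ is $\bigl(\prod_{\mathscr U}K_i\bigr)$-linear.
   Context: For a sequence of sets $A_i$, two sequences $(a_i),(a_i')\in\prod_iA_i$ are $\sim_{\mathscr U}$-equivalent if $\{i\in\mathbb N\mid a_i=a_i'\}\in\mathscr U$; $\prod_{\mathscr U}A_i$ is the quotient set. A statement holds "for $\mathscr U$-almost every $i$" if the set of $i$ for which it holds belongs to $\mathscr U$. In the ultraproduct of categories, source, target, identities, composition, and all further structure (tensor product, associators, unitors, duals, addition of morphisms, braidings, scalar multiplication) are defined termwise on representatives.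
   Formalization: For the monoidal, rigid, braided, symmetric, additive and abelian claims every C_i is assumed to have an object, and for the linear claim every K_i to be nonempty; otherwise one empty factor at a negligible index makes the ultraproduct empty and the claim false. *)

theory Defs
  imports "HOL-Algebra.Module"
begin

section \<open>Small categories\<close>

record ('o, 'm) category =
  objs :: "'o set"
  mors :: "'m set"
  source :: "'m \<Rightarrow> 'o"
  target :: "'m \<Rightarrow> 'o"
  ident :: "'o \<Rightarrow> 'm"
  cmp :: "'m \<Rightarrow> 'm \<Rightarrow> 'm"  (infixr \<open>\<cdot>\<index>\<close> 60)

text \<open>The composite \<open>g \<cdot> f\<close> (first \<open>f\<close>, then \<open>g\<close>) is only meaningful when the target of \<open>f\<close> is
  the source of \<open>g\<close>; as for all structure below, values outside the carriers are irrelevant.\<close>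

definition homs :: "('o, 'm) category \<Rightarrow> 'o \<Rightarrow> 'o \<Rightarrow> 'm set"
  where "homs C X Y = {f \<in> mors C. source C f = X \<and> target C f = Y}"

locale small_category =
  fixes C :: "('o, 'm) category" (structure)
  assumes source_closed: "f \<in> mors C \<Longrightarrow> source C f \<in> objs C"
    and target_closed: "f \<in> mors C \<Longrightarrow> target C f \<in> objs C"
    and ident_closed: "X \<in> objs C \<Longrightarrow> ident C X \<in> homs C X X"
    and cmp_closed: "f \<in> homs C X Y \<Longrightarrow> g \<in> homs C Y Z \<Longrightarrow> g \<cdot> f \<in> homs C X Z"
    and cmp_ident: "f \<in> homs C X Y \<Longrightarrow> f \<cdot> ident C X = f"
    and ident_cmp: "f \<in> homs C X Y \<Longrightarrow> ident C Y \<cdot> f = f"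
    and cmp_assoc: "f \<in> homs C W X \<Longrightarrow> g \<in> homs C X Y \<Longrightarrow> h \<in> homs C Y Z \<Longrightarrow>
      (h \<cdot> g) \<cdot> f = h \<cdot> (g \<cdot> f)"

definition inverse_mors :: "('o, 'm) category \<Rightarrow> 'm \<Rightarrow> 'm \<Rightarrow> bool"
  where "inverse_mors C f g \<longleftrightarrow> f \<in> mors C \<and> g \<in> homs C (target C f) (source C f) \<and>
    g \<cdot>\<^bsub>C\<^esub> f = ident C (source C f) \<and> f \<cdot>\<^bsub>C\<^esub> g = ident C (target C f)"

definition isos :: "('o, 'm) category \<Rightarrow> 'o \<Rightarrow> 'o \<Rightarrow> 'm set"
  where "isos C X Y = {f \<in> homs C X Y. \<exists>g. inverse_mors C f g}"

definition inv_mor :: "('o, 'm) category \<Rightarrow> 'm \<Rightarrow> 'm"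
  where "inv_mor C f = (THE g. inverse_mors C f g)"

definition idempotent_complete :: "('o, 'm) category \<Rightarrow> bool"
  where "idempotent_complete C \<longleftrightarrow>
    (\<forall>X\<in>objs C. \<forall>e\<in>homs C X X. e \<cdot>\<^bsub>C\<^esub> e = e \<longrightarrow>
      (\<exists>Y\<in>objs C. \<exists>r\<in>homs C X Y. \<exists>s\<in>homs C Y X.
        r \<cdot>\<^bsub>C\<^esub> s = ident C Y \<and> s \<cdot>\<^bsub>C\<^esub> r = e))"


section \<open>Monoidal, rigid, braided and symmetric categories\<close>

record ('o, 'm) monoidal_data =
  tens :: "'o \<Rightarrow> 'o \<Rightarrow> 'o"  (infixr \<open>\<boxtimes>\<index>\<close> 75)
  tens_mor :: "'m \<Rightarrow> 'm \<Rightarrow> 'm"  (infixr \<open>\<boxdot>\<index>\<close> 75)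
  tens_unit :: "'o"
  associator :: "'o \<Rightarrow> 'o \<Rightarrow> 'o \<Rightarrow> 'm"
  left_unitor :: "'o \<Rightarrow> 'm"
  right_unitor :: "'o \<Rightarrow> 'm"

locale monoidal_category = small_category C
  for C :: "('o, 'm) category" (structure) +
  fixes M :: "('o, 'm) monoidal_data"
  assumes tens_closed: "X \<in> objs C \<Longrightarrow> Y \<in> objs C \<Longrightarrow> X \<boxtimes>\<^bsub>M\<^esub> Y \<in> objs C"
    and tens_mor_closed: "f \<in> homs C X X' \<Longrightarrow> g \<in> homs C Y Y' \<Longrightarrow>
      f \<boxdot>\<^bsub>M\<^esub> g \<in> homs C (X \<boxtimes>\<^bsub>M\<^esub> Y) (X' \<boxtimes>\<^bsub>M\<^esub> Y')"
    and tens_ident: "X \<in> objs C \<Longrightarrow> Y \<in> objs C \<Longrightarrow>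
      ident C X \<boxdot>\<^bsub>M\<^esub> ident C Y = ident C (X \<boxtimes>\<^bsub>M\<^esub> Y)"
    and tens_cmp: "f \<in> homs C X X' \<Longrightarrow> f' \<in> homs C X' X'' \<Longrightarrow>
      g \<in> homs C Y Y' \<Longrightarrow> g' \<in> homs C Y' Y'' \<Longrightarrow>
      (f' \<cdot> f) \<boxdot>\<^bsub>M\<^esub> (g' \<cdot> g) = (f' \<boxdot>\<^bsub>M\<^esub> g') \<cdot> (f \<boxdot>\<^bsub>M\<^esub> g)"
    and tens_unit_closed: "tens_unit M \<in> objs C"
    and associator_iso: "X \<in> objs C \<Longrightarrow> Y \<in> objs C \<Longrightarrow> Z \<in> objs C \<Longrightarrow>
      associator M X Y Z \<in> isos C ((X \<boxtimes>\<^bsub>M\<^esub> Y) \<boxtimes>\<^bsub>M\<^esub> Z) (X \<boxtimes>\<^bsub>M\<^esub> (Y \<boxtimes>\<^bsub>M\<^esub> Z))"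
    and associator_natural: "f \<in> homs C X X' \<Longrightarrow> g \<in> homs C Y Y' \<Longrightarrow> h \<in> homs C Z Z' \<Longrightarrow>
      associator M X' Y' Z' \<cdot> ((f \<boxdot>\<^bsub>M\<^esub> g) \<boxdot>\<^bsub>M\<^esub> h) =
      (f \<boxdot>\<^bsub>M\<^esub> (g \<boxdot>\<^bsub>M\<^esub> h)) \<cdot> associator M X Y Z"
    and left_unitor_iso: "X \<in> objs C \<Longrightarrow>
      left_unitor M X \<in> isos C (tens_unit M \<boxtimes>\<^bsub>M\<^esub> X) X"
    and left_unitor_natural: "f \<in> homs C X X' \<Longrightarrow>
      left_unitor M X' \<cdot> (ident C (tens_unit M) \<boxdot>\<^bsub>M\<^esub> f) = f \<cdot> left_unitor M X"
    and right_unitor_iso: "X \<in> objs C \<Longrightarrow>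
      right_unitor M X \<in> isos C (X \<boxtimes>\<^bsub>M\<^esub> tens_unit M) X"
    and right_unitor_natural: "f \<in> homs C X X' \<Longrightarrow>
      right_unitor M X' \<cdot> (f \<boxdot>\<^bsub>M\<^esub> ident C (tens_unit M)) = f \<cdot> right_unitor M X"
    and pentagon: "W \<in> objs C \<Longrightarrow> X \<in> objs C \<Longrightarrow> Y \<in> objs C \<Longrightarrow> Z \<in> objs C \<Longrightarrow>
      (ident C W \<boxdot>\<^bsub>M\<^esub> associator M X Y Z) \<cdot> associator M W (X \<boxtimes>\<^bsub>M\<^esub> Y) Z \<cdot>
        (associator M W X Y \<boxdot>\<^bsub>M\<^esub> ident C Z) =
      associator M W X (Y \<boxtimes>\<^bsub>M\<^esub> Z) \<cdot> associator M (W \<boxtimes>\<^bsub>M\<^esub> X) Y Z"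
    and triangle: "X \<in> objs C \<Longrightarrow> Y \<in> objs C \<Longrightarrow>
      (ident C X \<boxdot>\<^bsub>M\<^esub> left_unitor M Y) \<cdot> associator M X (tens_unit M) Y =
      right_unitor M X \<boxdot>\<^bsub>M\<^esub> ident C Y"

text \<open>\<open>Y\<close> is a left dual of \<open>X\<close> with evaluation \<open>ev : Y \<otimes> X \<rightarrow> 1\<close> and coevaluation
  \<open>coev : 1 \<rightarrow> X \<otimes> Y\<close> (equivalently, \<open>X\<close> is a right dual of \<open>Y\<close>).\<close>

definition is_dual ::
    "('o, 'm) category \<Rightarrow> ('o, 'm) monoidal_data \<Rightarrow> 'o \<Rightarrow> 'o \<Rightarrow> 'm \<Rightarrow> 'm \<Rightarrow> bool"
  where "is_dual C M X Y ev coev \<longleftrightarrow> X \<in> objs C \<and> Y \<in> objs C \<and>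
    ev \<in> homs C (Y \<boxtimes>\<^bsub>M\<^esub> X) (tens_unit M) \<and> coev \<in> homs C (tens_unit M) (X \<boxtimes>\<^bsub>M\<^esub> Y) \<and>
    right_unitor M X \<cdot>\<^bsub>C\<^esub> (ident C X \<boxdot>\<^bsub>M\<^esub> ev) \<cdot>\<^bsub>C\<^esub> associator M X Y X \<cdot>\<^bsub>C\<^esub>
      (coev \<boxdot>\<^bsub>M\<^esub> ident C X) \<cdot>\<^bsub>C\<^esub> inv_mor C (left_unitor M X) = ident C X \<and>
    left_unitor M Y \<cdot>\<^bsub>C\<^esub> (ev \<boxdot>\<^bsub>M\<^esub> ident C Y) \<cdot>\<^bsub>C\<^esub> inv_mor C (associator M Y X Y) \<cdot>\<^bsub>C\<^esub>
      (ident C Y \<boxdot>\<^bsub>M\<^esub> coev) \<cdot>\<^bsub>C\<^esub> inv_mor C (right_unitor M Y) = ident C Y"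

locale rigid_category = monoidal_category C M
  for C :: "('o, 'm) category" (structure) and M :: "('o, 'm) monoidal_data" +
  assumes left_dual: "X \<in> objs C \<Longrightarrow> \<exists>Y ev coev. is_dual C M X Y ev coev"
    and right_dual: "X \<in> objs C \<Longrightarrow> \<exists>Y ev coev. is_dual C M Y X ev coev"

locale braided_category = monoidal_category C M
  for C :: "('o, 'm) category" (structure) and M :: "('o, 'm) monoidal_data" +
  fixes braid :: "'o \<Rightarrow> 'o \<Rightarrow> 'm"
  assumes braid_iso: "X \<in> objs C \<Longrightarrow> Y \<in> objs C \<Longrightarrow>
      braid X Y \<in> isos C (X \<boxtimes>\<^bsub>M\<^esub> Y) (Y \<boxtimes>\<^bsub>M\<^esub> X)"
    and braid_natural: "f \<in> homs C X X' \<Longrightarrow> g \<in> homs C Y Y' \<Longrightarrow>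
      braid X' Y' \<cdot> (f \<boxdot>\<^bsub>M\<^esub> g) = (g \<boxdot>\<^bsub>M\<^esub> f) \<cdot> braid X Y"
    and hexagon1: "X \<in> objs C \<Longrightarrow> Y \<in> objs C \<Longrightarrow> Z \<in> objs C \<Longrightarrow>
      associator M Y Z X \<cdot> braid X (Y \<boxtimes>\<^bsub>M\<^esub> Z) \<cdot> associator M X Y Z =
      (ident C Y \<boxdot>\<^bsub>M\<^esub> braid X Z) \<cdot> associator M Y X Z \<cdot> (braid X Y \<boxdot>\<^bsub>M\<^esub> ident C Z)"
    and hexagon2: "X \<in> objs C \<Longrightarrow> Y \<in> objs C \<Longrightarrow> Z \<in> objs C \<Longrightarrow>
      inv_mor C (associator M Z X Y) \<cdot> braid (X \<boxtimes>\<^bsub>M\<^esub> Y) Z \<cdot> inv_mor C (associator M X Y Z) =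
      (braid X Z \<boxdot>\<^bsub>M\<^esub> ident C Y) \<cdot> inv_mor C (associator M X Z Y) \<cdot>
        (ident C X \<boxdot>\<^bsub>M\<^esub> braid Y Z)"

locale symmetric_category = braided_category C M braid
  for C :: "('o, 'm) category" (structure) and M :: "('o, 'm) monoidal_data"
    and braid :: "'o \<Rightarrow> 'o \<Rightarrow> 'm" +
  assumes braid_symmetric: "X \<in> objs C \<Longrightarrow> Y \<in> objs C \<Longrightarrow>
    braid Y X \<cdot> braid X Y = ident C (X \<boxtimes>\<^bsub>M\<^esub> Y)"


section \<open>Additive, abelian and linear categories\<close>

text \<open>One binary operation on morphisms carries the additions of all hom-sets; the zero morphism
  depends on source and target.\<close>

record ('o, 'm) additive_data =
  add_mor :: "'m \<Rightarrow> 'm \<Rightarrow> 'm"  (infixl \<open>\<boxplus>\<index>\<close> 55)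
  zero_mor :: "'o \<Rightarrow> 'o \<Rightarrow> 'm"

definition hom_group ::
    "('o, 'm) category \<Rightarrow> ('o, 'm) additive_data \<Rightarrow> 'o \<Rightarrow> 'o \<Rightarrow> 'm monoid"
  where "hom_group C A X Y =
    \<lparr>carrier = homs C X Y, monoid.mult = add_mor A, one = zero_mor A X Y\<rparr>"

locale preadditive_category = small_category C
  for C :: "('o, 'm) category" (structure) +
  fixes A :: "('o, 'm) additive_data"
  assumes hom_comm_group: "X \<in> objs C \<Longrightarrow> Y \<in> objs C \<Longrightarrow> comm_group (hom_group C A X Y)"
    and cmp_add_right: "f \<in> homs C X Y \<Longrightarrow> f' \<in> homs C X Y \<Longrightarrow> g \<in> homs C Y Z \<Longrightarrow>
      g \<cdot> (f \<boxplus>\<^bsub>A\<^esub> f') = (g \<cdot> f) \<boxplus>\<^bsub>A\<^esub> (g \<cdot> f')"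
    and cmp_add_left: "f \<in> homs C X Y \<Longrightarrow> g \<in> homs C Y Z \<Longrightarrow> g' \<in> homs C Y Z \<Longrightarrow>
      (g \<boxplus>\<^bsub>A\<^esub> g') \<cdot> f = (g \<cdot> f) \<boxplus>\<^bsub>A\<^esub> (g' \<cdot> f)"

definition zero_object :: "('o, 'm) category \<Rightarrow> 'o \<Rightarrow> bool"
  where "zero_object C Z \<longleftrightarrow> Z \<in> objs C \<and>
    (\<forall>X\<in>objs C. (\<exists>!f. f \<in> homs C X Z) \<and> (\<exists>!f. f \<in> homs C Z X))"

definition is_biproduct :: "('o, 'm) category \<Rightarrow> ('o, 'm) additive_data \<Rightarrow>
    'o \<Rightarrow> 'o \<Rightarrow> 'o \<Rightarrow> 'm \<Rightarrow> 'm \<Rightarrow> 'm \<Rightarrow> 'm \<Rightarrow> bool"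
  where "is_biproduct C A X1 X2 P i1 i2 p1 p2 \<longleftrightarrow> P \<in> objs C \<and>
    i1 \<in> homs C X1 P \<and> i2 \<in> homs C X2 P \<and> p1 \<in> homs C P X1 \<and> p2 \<in> homs C P X2 \<and>
    p1 \<cdot>\<^bsub>C\<^esub> i1 = ident C X1 \<and> p2 \<cdot>\<^bsub>C\<^esub> i2 = ident C X2 \<and>
    p1 \<cdot>\<^bsub>C\<^esub> i2 = zero_mor A X2 X1 \<and> p2 \<cdot>\<^bsub>C\<^esub> i1 = zero_mor A X1 X2 \<and>
    (i1 \<cdot>\<^bsub>C\<^esub> p1) \<boxplus>\<^bsub>A\<^esub> (i2 \<cdot>\<^bsub>C\<^esub> p2) = ident C P"

locale additive_category = preadditive_category C A
  for C :: "('o, 'm) category" (structure) and A :: "('o, 'm) additive_data" +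
  assumes ex_zero_object: "\<exists>Z. zero_object C Z"
    and ex_biproduct: "X1 \<in> objs C \<Longrightarrow> X2 \<in> objs C \<Longrightarrow>
      \<exists>P i1 i2 p1 p2. is_biproduct C A X1 X2 P i1 i2 p1 p2"

definition is_kernel ::
    "('o, 'm) category \<Rightarrow> ('o, 'm) additive_data \<Rightarrow> 'm \<Rightarrow> 'm \<Rightarrow> bool"
  where "is_kernel C A f k \<longleftrightarrow> f \<in> mors C \<and> k \<in> mors C \<and> target C k = source C f \<and>
    f \<cdot>\<^bsub>C\<^esub> k = zero_mor A (source C k) (target C f) \<and>
    (\<forall>g\<in>mors C. target C g = source C f \<and> f \<cdot>\<^bsub>C\<^esub> g = zero_mor A (source C g) (target C f) \<longrightarrow>
      (\<exists>!h. h \<in> homs C (source C g) (source C k) \<and> k \<cdot>\<^bsub>C\<^esub> h = g))"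

definition is_cokernel ::
    "('o, 'm) category \<Rightarrow> ('o, 'm) additive_data \<Rightarrow> 'm \<Rightarrow> 'm \<Rightarrow> bool"
  where "is_cokernel C A f c \<longleftrightarrow> f \<in> mors C \<and> c \<in> mors C \<and> source C c = target C f \<and>
    c \<cdot>\<^bsub>C\<^esub> f = zero_mor A (source C f) (target C c) \<and>
    (\<forall>g\<in>mors C. source C g = target C f \<and> g \<cdot>\<^bsub>C\<^esub> f = zero_mor A (source C f) (target C g) \<longrightarrow>
      (\<exists>!h. h \<in> homs C (target C c) (target C g) \<and> h \<cdot>\<^bsub>C\<^esub> c = g))"

definition is_mono :: "('o, 'm) category \<Rightarrow> 'm \<Rightarrow> bool"
  where "is_mono C f \<longleftrightarrow> f \<in> mors C \<and>
    (\<forall>W. \<forall>g\<in>homs C W (source C f). \<forall>h\<in>homs C W (source C f).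
      f \<cdot>\<^bsub>C\<^esub> g = f \<cdot>\<^bsub>C\<^esub> h \<longrightarrow> g = h)"

definition is_epi :: "('o, 'm) category \<Rightarrow> 'm \<Rightarrow> bool"
  where "is_epi C f \<longleftrightarrow> f \<in> mors C \<and>
    (\<forall>W. \<forall>g\<in>homs C (target C f) W. \<forall>h\<in>homs C (target C f) W.
      g \<cdot>\<^bsub>C\<^esub> f = h \<cdot>\<^bsub>C\<^esub> f \<longrightarrow> g = h)"

locale abelian_category = additive_category C A
  for C :: "('o, 'm) category" (structure) and A :: "('o, 'm) additive_data" +
  assumes ex_kernel: "f \<in> mors C \<Longrightarrow> \<exists>k. is_kernel C A f k"
    and ex_cokernel: "f \<in> mors C \<Longrightarrow> \<exists>c. is_cokernel C A f c"
    and mono_normal: "is_mono C f \<Longrightarrow> \<exists>g. is_kernel C A g f"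
    and epi_normal: "is_epi C f \<Longrightarrow> \<exists>g. is_cokernel C A g f"

text \<open>In the library record of modules the fields \<open>mult\<close> and \<open>one\<close> are not constrained by the
  locale \<open>module\<close>, so they are left unspecified here.\<close>

definition hom_module :: "('o, 'm) category \<Rightarrow> ('o, 'm) additive_data \<Rightarrow>
    ('k \<Rightarrow> 'm \<Rightarrow> 'm) \<Rightarrow> 'o \<Rightarrow> 'o \<Rightarrow> ('k, 'm) module"
  where "hom_module C A scal X Y = \<lparr>carrier = homs C X Y, monoid.mult = undefined, one = undefined,
    zero = zero_mor A X Y, add = add_mor A, smult = scal\<rparr>"

locale linear_category = preadditive_category C A
  for C :: "('o, 'm) category" (structure) and A :: "('o, 'm) additive_data" +
  fixes K :: "'k ring" and scal :: "'k \<Rightarrow> 'm \<Rightarrow> 'm"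
  assumes hom_is_module: "X \<in> objs C \<Longrightarrow> Y \<in> objs C \<Longrightarrow> module K (hom_module C A scal X Y)"
    and cmp_scal_right: "a \<in> carrier K \<Longrightarrow> f \<in> homs C X Y \<Longrightarrow> g \<in> homs C Y Z \<Longrightarrow>
      g \<cdot> scal a f = scal a (g \<cdot> f)"
    and cmp_scal_left: "a \<in> carrier K \<Longrightarrow> f \<in> homs C X Y \<Longrightarrow> g \<in> homs C Y Z \<Longrightarrow>
      scal a g \<cdot> f = scal a (g \<cdot> f)"


section \<open>Ultraproducts\<close>

text \<open>A family of subsets of an index type is represented by the library type of filters:
  \<open>S\<close> belongs to \<open>U\<close> iff \<open>eventually (\<lambda>i. i \<in> S) U\<close>. The library filter \<open>bot\<close> is the improper one.\<close>

locale ultrafilter =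
  fixes U :: "'i filter"
  assumes proper: "U \<noteq> bot"
    and ultra: "eventually P U \<or> eventually (\<lambda>i. \<not> P i) U"

definition ultra_rel :: "'i filter \<Rightarrow> ('i \<Rightarrow> 'a set) \<Rightarrow> (('i \<Rightarrow> 'a) \<times> ('i \<Rightarrow> 'a)) set"
  where "ultra_rel U S =
    {(a, b). a \<in> Pi UNIV S \<and> b \<in> Pi UNIV S \<and> (\<forall>\<^sub>F i in U. a i = b i)}"

text \<open>The quotient of the full product: it is empty as soon as a single factor is empty, even if that
  factor sits at an index that \<open>U\<close> ignores. Structure containing distinguished elements (a unit
  object, a zero object, the constants of a field) therefore only transfers from almost every index
  when no factor is empty.\<close>

definition ultraprod :: "'i filter \<Rightarrow> ('i \<Rightarrow> 'a set) \<Rightarrow> ('i \<Rightarrow> 'a) set set"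
  where "ultraprod U S = Pi UNIV S // ultra_rel U S"

text \<open>The class represented by \<open>t\<close>. The representative may leave \<open>S i\<close> at indices outside a set in
  the ultrafilter; this happens for termwise operations that are only meaningful at almost every
  index, such as the composition of representatives that are only almost everywhere composable.\<close>

definition ultra_class :: "'i filter \<Rightarrow> ('i \<Rightarrow> 'a set) \<Rightarrow> ('i \<Rightarrow> 'a) \<Rightarrow> ('i \<Rightarrow> 'a) set"
  where "ultra_class U S t = {b \<in> Pi UNIV S. \<forall>\<^sub>F i in U. b i = t i}"

lemma ultra_class_eq_Image: "a \<in> Pi UNIV S \<Longrightarrow> ultra_class U S a = ultra_rel U S `` {a}"
  by (auto simp: ultra_class_def ultra_rel_def eq_commute)

lemma equiv_ultra_rel: "equiv (Pi UNIV S) (ultra_rel U S)"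
proof (rule equivI)
  show "ultra_rel U S \<subseteq> Pi UNIV S \<times> Pi UNIV S"
    by (auto simp: ultra_rel_def)
  show "refl_on (Pi UNIV S) (ultra_rel U S)"
    by (auto simp: refl_on_def ultra_rel_def)
  show "sym (ultra_rel U S)"
    by (auto simp: sym_def ultra_rel_def eq_commute)
  show "trans (ultra_rel U S)"
    by (auto simp: trans_def ultra_rel_def elim: eventually_elim2)
qed

text \<open>Termwise operations on classes, as unions over all representatives (as in the theory of
  equivalence relations of the library). Hence if the result is again a class, that is, an element
  of \<open>ultraprod U S\<close>, then it does not depend on the representatives.\<close>

definition ulift1 :: "'i filter \<Rightarrow> ('i \<Rightarrow> 'c set) \<Rightarrow> ('i \<Rightarrow> 'a \<Rightarrow> 'c) \<Rightarrow>
    ('i \<Rightarrow> 'a) set \<Rightarrow> ('i \<Rightarrow> 'c) set"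
  where "ulift1 U S p F = (\<Union>f\<in>F. ultra_class U S (\<lambda>i. p i (f i)))"

definition ulift2 :: "'i filter \<Rightarrow> ('i \<Rightarrow> 'c set) \<Rightarrow> ('i \<Rightarrow> 'a \<Rightarrow> 'b \<Rightarrow> 'c) \<Rightarrow>
    ('i \<Rightarrow> 'a) set \<Rightarrow> ('i \<Rightarrow> 'b) set \<Rightarrow> ('i \<Rightarrow> 'c) set"
  where "ulift2 U S p F G = (\<Union>f\<in>F. \<Union>g\<in>G. ultra_class U S (\<lambda>i. p i (f i) (g i)))"

definition ulift3 :: "'i filter \<Rightarrow> ('i \<Rightarrow> 'd set) \<Rightarrow> ('i \<Rightarrow> 'a \<Rightarrow> 'b \<Rightarrow> 'c \<Rightarrow> 'd) \<Rightarrow>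
    ('i \<Rightarrow> 'a) set \<Rightarrow> ('i \<Rightarrow> 'b) set \<Rightarrow> ('i \<Rightarrow> 'c) set \<Rightarrow> ('i \<Rightarrow> 'd) set"
  where "ulift3 U S p F G H =
    (\<Union>f\<in>F. \<Union>g\<in>G. \<Union>h\<in>H. ultra_class U S (\<lambda>i. p i (f i) (g i) (h i)))"

definition ultra_cat ::
    "'i filter \<Rightarrow> ('i \<Rightarrow> ('o, 'm) category) \<Rightarrow> (('i \<Rightarrow> 'o) set, ('i \<Rightarrow> 'm) set) category"
  where "ultra_cat U C =
    \<lparr>objs = ultraprod U (\<lambda>i. objs (C i)),
     mors = ultraprod U (\<lambda>i. mors (C i)),
     source = ulift1 U (\<lambda>i. objs (C i)) (\<lambda>i. source (C i)),
     target = ulift1 U (\<lambda>i. objs (C i)) (\<lambda>i. target (C i)),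
     ident = ulift1 U (\<lambda>i. mors (C i)) (\<lambda>i. ident (C i)),
     cmp = ulift2 U (\<lambda>i. mors (C i)) (\<lambda>i. cmp (C i))\<rparr>"

definition ultra_monoidal :: "'i filter \<Rightarrow> ('i \<Rightarrow> ('o, 'm) category) \<Rightarrow>
    ('i \<Rightarrow> ('o, 'm) monoidal_data) \<Rightarrow> (('i \<Rightarrow> 'o) set, ('i \<Rightarrow> 'm) set) monoidal_data"
  where "ultra_monoidal U C M =
    \<lparr>tens = ulift2 U (\<lambda>i. objs (C i)) (\<lambda>i. tens (M i)),
     tens_mor = ulift2 U (\<lambda>i. mors (C i)) (\<lambda>i. tens_mor (M i)),
     tens_unit = ultra_class U (\<lambda>i. objs (C i)) (\<lambda>i. tens_unit (M i)),
     associator = ulift3 U (\<lambda>i. mors (C i)) (\<lambda>i. associator (M i)),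
     left_unitor = ulift1 U (\<lambda>i. mors (C i)) (\<lambda>i. left_unitor (M i)),
     right_unitor = ulift1 U (\<lambda>i. mors (C i)) (\<lambda>i. right_unitor (M i))\<rparr>"

definition ultra_braid :: "'i filter \<Rightarrow> ('i \<Rightarrow> ('o, 'm) category) \<Rightarrow>
    ('i \<Rightarrow> 'o \<Rightarrow> 'o \<Rightarrow> 'm) \<Rightarrow> ('i \<Rightarrow> 'o) set \<Rightarrow> ('i \<Rightarrow> 'o) set \<Rightarrow> ('i \<Rightarrow> 'm) set"
  where "ultra_braid U C c = ulift2 U (\<lambda>i. mors (C i)) c"

definition ultra_additive :: "'i filter \<Rightarrow> ('i \<Rightarrow> ('o, 'm) category) \<Rightarrow>
    ('i \<Rightarrow> ('o, 'm) additive_data) \<Rightarrow> (('i \<Rightarrow> 'o) set, ('i \<Rightarrow> 'm) set) additive_data"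
  where "ultra_additive U C A =
    \<lparr>add_mor = ulift2 U (\<lambda>i. mors (C i)) (\<lambda>i. add_mor (A i)),
     zero_mor = ulift2 U (\<lambda>i. mors (C i)) (\<lambda>i. zero_mor (A i))\<rparr>"

definition ultra_ring :: "'i filter \<Rightarrow> ('i \<Rightarrow> 'k ring) \<Rightarrow> ('i \<Rightarrow> 'k) set ring"
  where "ultra_ring U K =
    \<lparr>carrier = ultraprod U (\<lambda>i. carrier (K i)),
     monoid.mult = ulift2 U (\<lambda>i. carrier (K i)) (\<lambda>i. monoid.mult (K i)),
     one = ultra_class U (\<lambda>i. carrier (K i)) (\<lambda>i. one (K i)),
     zero = ultra_class U (\<lambda>i. carrier (K i)) (\<lambda>i. zero (K i)),
     add = ulift2 U (\<lambda>i. carrier (K i)) (\<lambda>i. add (K i))\<rparr>"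

definition ultra_scal :: "'i filter \<Rightarrow> ('i \<Rightarrow> ('o, 'm) category) \<Rightarrow>
    ('i \<Rightarrow> 'k \<Rightarrow> 'm \<Rightarrow> 'm) \<Rightarrow> ('i \<Rightarrow> 'k) set \<Rightarrow> ('i \<Rightarrow> 'm) set \<Rightarrow> ('i \<Rightarrow> 'm) set"
  where "ultra_scal U C s = ulift2 U (\<lambda>i. mors (C i)) s"

end

theory Submission
  imports Defs
begin

text \<open>The ultraproduct of categories is governed by one principle (the part of Los's theorem that is
  needed here): a statement about classes built from the termwise structure follows from the same
  statement about the representatives at almost every index.

  For an equational axiom this is immediate once three facts are available. First, two classes are
  equal iff their representatives agree almost everywhere (\<open>rep_eq_iff\<close>). Secondly, every term in the
  structure of the ultraproduct is represented by the corresponding sequence of terms in the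
  factors, provided that these terms are well typed almost everywhere; the typing judgement
  \<open>arrow F f x y\<close> below records that the class \<open>F\<close> is represented by \<open>f\<close>, where almost every \<open>f i\<close> is a
  morphism from \<open>x i\<close> to \<open>y i\<close>, and there is one rule for each operation. Thirdly, every element of the
  ultraproduct has a representative. Hence an axiom is proved by representing its variables, typing
  both of its sides by these rules, and intersecting the finitely many sets of the filter on which
  the hypotheses hold; at each index of the intersection it is the axiom of the factor.

  Existential axioms (splittings of idempotents, duals, biproducts, kernels, inverses) follow by
  choosing a witness at almost every index and forming the class of the resulting sequence.
  Universal properties are handled by \<open>ex1_homs_UC\<close>: unique existence of a morphism passes from
  almost every factor to the ultraproduct. All of this holds for an arbitrary filter. That \<open>U\<close> is an
  ultrafilter matters only where a negation is transferred. A monomorphism or epimorphism of the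
  ultraproduct is represented by morphisms that are monic or epic almost everywhere
  (\<open>eventually_is_mono\<close>, \<open>eventually_is_epi\<close>), so that it is a kernel or cokernel because its
  representatives are so almost everywhere. Likewise a nonzero scalar has representatives that are nonzero almost
  everywhere, whence inverses in the ultraproduct of fields (\<open>field_UK\<close>); there \<open>0 \<noteq> 1\<close> holds because
  the filter is proper.\<close>


section \<open>Representatives of classes\<close>

text \<open>The class \<open>X\<close> is represented by \<open>x\<close>. The sequence need only lie in the factors almost everywhere, so
  that termwise values of partial operations are admitted. All factors are required to be nonempty
  because otherwise the product, and with it every class, is empty.\<close>

definition rep :: "'i filter \<Rightarrow> ('i \<Rightarrow> 'a set) \<Rightarrow> ('i \<Rightarrow> 'a) set \<Rightarrow> ('i \<Rightarrow> 'a) \<Rightarrow> bool"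
  where "rep U S X x \<longleftrightarrow>
    X = ultra_class U S x \<and> (\<forall>i. S i \<noteq> {}) \<and> (\<forall>\<^sub>F i in U. x i \<in> S i)"

text \<open>A chosen member of a class. Fixing the choice once makes the representatives of the source and
  target of a morphism independent of the morphism, so that composable morphisms of the
  ultraproduct have representatives that are visibly composable.\<close>

definition some_rep :: "('i \<Rightarrow> 'a) set \<Rightarrow> 'i \<Rightarrow> 'a"
  where "some_rep X = (SOME x. x \<in> X)"

lemma rep_class: "(\<And>i. S i \<noteq> {}) \<Longrightarrow> \<forall>\<^sub>F i in U. x i \<in> S i \<Longrightarrow> rep U S (ultra_class U S x) x"
  by (simp add: rep_def)

lemma rep_eventually: "rep U S X x \<Longrightarrow> \<forall>\<^sub>F i in U. x i \<in> S i"
  by (simp add: rep_def)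

lemma rep_nonempty: "rep U S X x \<Longrightarrow> S i \<noteq> {}"
  by (simp add: rep_def)

lemma ultra_class_cong:
  assumes "\<forall>\<^sub>F i in U. x i = y i"
  shows "ultra_class U S x = ultra_class U S y"
proof -
  have "(\<forall>\<^sub>F i in U. b i = x i) \<longleftrightarrow> (\<forall>\<^sub>F i in U. b i = y i)" for b
    by (rule eventually_subst) (use assms in eventually_elim, simp)
  then show ?thesis by (simp add: ultra_class_def)
qed

lemma rep_ex_member:
  assumes "rep U S X x"
  obtains a where "a \<in> Pi UNIV S" "\<forall>\<^sub>F i in U. a i = x i" "a \<in> X" "X = ultra_class U S a"
proof -
  \<comment> \<open>Values outside the factors, which occur only at negligible indices, are replaced arbitrarily.\<close>
  define a where "a i = (if x i \<in> S i then x i else (SOME s. s \<in> S i))" for i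
  have 1: "a \<in> Pi UNIV S"
    using assms by (auto simp: a_def rep_def some_in_eq)
  have 2: "\<forall>\<^sub>F i in U. a i = x i"
    using rep_eventually[OF assms] by eventually_elim (simp add: a_def)
  moreover have "a \<in> X" using 1 2 assms by (simp add: rep_def ultra_class_def)
  moreover have "X = ultra_class U S a"
    using assms ultra_class_cong[OF 2] by (simp add: rep_def)
  ultimately show thesis using that 1 by blast
qed

lemma rep_eqI: "rep U S X x \<Longrightarrow> rep U S Y y \<Longrightarrow> \<forall>\<^sub>F i in U. x i = y i \<Longrightarrow> X = Y"
  using ultra_class_cong[of x y U S] by (simp add: rep_def)

lemma rep_eq_iff:
  assumes "rep U S X x" "rep U S Y y"
  shows "X = Y \<longleftrightarrow> (\<forall>\<^sub>F i in U. x i = y i)"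
proof
  assume "X = Y"
  moreover obtain a where "a \<in> X" using rep_ex_member[OF assms(1)] by blast
  ultimately have "\<forall>\<^sub>F i in U. a i = x i" "\<forall>\<^sub>F i in U. a i = y i"
    using assms by (auto simp: rep_def ultra_class_def)
  then show "\<forall>\<^sub>F i in U. x i = y i" by eventually_elim simp
qed (rule rep_eqI[OF assms])

lemma ultraprod_eq: "ultraprod U S = ultra_class U S ` Pi UNIV S"
  by (auto simp: ultraprod_def quotient_def ultra_class_eq_Image)

lemma rep_in_ultraprod: "rep U S X x \<Longrightarrow> X \<in> ultraprod U S"
  by (erule rep_ex_member) (simp add: ultraprod_eq)

lemma rep_some_rep:
  assumes "X \<in> ultraprod U S"
  shows "rep U S X (some_rep X)"
proof -
  obtain a where a: "a \<in> Pi UNIV S" "X = ultra_class U S a"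
    using assms by (auto simp: ultraprod_eq)
  then have "a \<in> X" by (simp add: ultra_class_def)
  then have "some_rep X \<in> X" unfolding some_rep_def by (rule someI[where P = "\<lambda>x. x \<in> X"])
  then have r: "some_rep X \<in> Pi UNIV S" "\<forall>\<^sub>F i in U. some_rep X i = a i"
    using a by (auto simp: ultra_class_def)
  then show ?thesis
    using a ultra_class_cong[OF r(2), of S] by (auto simp: rep_def Pi_iff intro: always_eventually)
qed

lemma rep_member: "rep U S X x \<Longrightarrow> a \<in> X \<Longrightarrow> \<forall>\<^sub>F i in U. a i = x i"
  by (simp add: rep_def ultra_class_def)

lemma rep_lift1:
  assumes X: "rep U S X x" and ne: "\<And>i. T i \<noteq> {}"
    and ev: "\<forall>\<^sub>F i in U. p i (x i) \<in> T i"
  shows "rep U T (ulift1 U T p X) (\<lambda>i. p i (x i))"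
proof -
  have "ultra_class U T (\<lambda>i. p i (a i)) = ultra_class U T (\<lambda>i. p i (x i))" if "a \<in> X" for a
    by (rule ultra_class_cong, use rep_member[OF X that] in eventually_elim) simp
  moreover have "X \<noteq> {}" using rep_ex_member[OF X] by blast
  ultimately show ?thesis using ne ev by (auto simp: rep_def ulift1_def)
qed

lemma rep_lift2:
  assumes X: "rep U S X x" and Y: "rep U S' Y y" and ne: "\<And>i. T i \<noteq> {}"
    and ev: "\<forall>\<^sub>F i in U. p i (x i) (y i) \<in> T i"
  shows "rep U T (ulift2 U T p X Y) (\<lambda>i. p i (x i) (y i))"
proof -
  have "ultra_class U T (\<lambda>i. p i (a i) (b i)) = ultra_class U T (\<lambda>i. p i (x i) (y i))"
    if "a \<in> X" "b \<in> Y" for a b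
    by (rule ultra_class_cong, use rep_member[OF X that(1)] rep_member[OF Y that(2)] in eventually_elim)
      simp
  moreover have "X \<noteq> {}" "Y \<noteq> {}" using rep_ex_member[OF X] rep_ex_member[OF Y] by blast+
  ultimately show ?thesis using ne ev by (auto simp: rep_def ulift2_def)
qed

lemma rep_lift3:
  assumes X: "rep U S X x" and Y: "rep U S' Y y" and Z: "rep U S'' Z z" and ne: "\<And>i. T i \<noteq> {}"
    and ev: "\<forall>\<^sub>F i in U. p i (x i) (y i) (z i) \<in> T i"
  shows "rep U T (ulift3 U T p X Y Z) (\<lambda>i. p i (x i) (y i) (z i))"
proof -
  have "ultra_class U T (\<lambda>i. p i (a i) (b i) (c i)) = ultra_class U T (\<lambda>i. p i (x i) (y i) (z i))"
    if abc: "a \<in> X" "b \<in> Y" "c \<in> Z" for a b c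
    by (rule ultra_class_cong,
        use rep_member[OF X abc(1)] rep_member[OF Y abc(2)] rep_member[OF Z abc(3)] in eventually_elim) simp
  moreover have "X \<noteq> {}" "Y \<noteq> {}" "Z \<noteq> {}"
    using rep_ex_member[OF X] rep_ex_member[OF Y] rep_ex_member[OF Z] by blast+
  ultimately show ?thesis using ne ev by (auto simp: rep_def ulift3_def)
qed


lemma (in ultrafilter) eventually_not_iff: "\<not> eventually P U \<longleftrightarrow> (\<forall>\<^sub>F i in U. \<not> P i)"
  using ultra[of P] proper eventually_conj[of P U "\<lambda>i. \<not> P i"]
  by (auto simp: trivial_limit_def)


section \<open>Ultraproducts of categories\<close>

lemma homs_if_isos: "f \<in> isos D X Y \<Longrightarrow> f \<in> homs D X Y"
  by (simp add: isos_def)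

text \<open>A sequence of small categories over an index set with an ultrafilter. All factors, not just
  almost all, are categories. Hence a factor has a morphism iff it has an object, and as soon as the
  ultraproduct has an object or a morphism, no factor is empty.\<close>

locale category_family = ultrafilter U
  for U :: "'i filter" +
  fixes C :: "'i \<Rightarrow> ('o, 'm) category"
  assumes small: "small_category (C i)"
begin

abbreviation UC where "UC \<equiv> ultra_cat U C"

abbreviation ob where "ob \<equiv> rep U (\<lambda>i. objs (C i))"

abbreviation mor where "mor \<equiv> rep U (\<lambda>i. mors (C i))"

text \<open>The class \<open>F\<close> is represented by \<open>f\<close>, and \<open>f i\<close> runs from \<open>x i\<close> to \<open>y i\<close> for almost every \<open>i\<close>. This
  judgement refers to sequences \<open>x\<close> and \<open>y\<close> instead of classes; the endpoints of a composite term are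
  then computed by unification from those of its parts.\<close>

definition arrow :: "('i \<Rightarrow> 'm) set \<Rightarrow> ('i \<Rightarrow> 'm) \<Rightarrow> ('i \<Rightarrow> 'o) \<Rightarrow> ('i \<Rightarrow> 'o) \<Rightarrow> bool"
  where "arrow F f x y \<longleftrightarrow> mor F f \<and> (\<forall>\<^sub>F i in U. f i \<in> homs (C i) (x i) (y i))"

lemma arrow_rep: "arrow F f x y \<Longrightarrow> mor F f"
  by (simp add: arrow_def)

lemma arrow_eventually: "arrow F f x y \<Longrightarrow> \<forall>\<^sub>F i in U. f i \<in> homs (C i) (x i) (y i)"
  by (simp add: arrow_def)

lemma arrow_eqI: "arrow F f x y \<Longrightarrow> arrow G g x' y' \<Longrightarrow> \<forall>\<^sub>F i in U. f i = g i \<Longrightarrow> F = G"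
  using arrow_rep rep_eqI by blast

lemma mors_nonempty_iff: "mors (C i) \<noteq> {} \<longleftrightarrow> objs (C i) \<noteq> {}"
  using small_category.source_closed[OF small, of _ i] small_category.ident_closed[OF small, of _ i]
  by (fastforce simp: homs_def)

lemma objs_UC: "objs UC = ultraprod U (\<lambda>i. objs (C i))"
  and mors_UC: "mors UC = ultraprod U (\<lambda>i. mors (C i))"
  by (simp_all add: ultra_cat_def)

lemma UC_simps:
  "source UC = ulift1 U (\<lambda>i. objs (C i)) (\<lambda>i. source (C i))"
  "target UC = ulift1 U (\<lambda>i. objs (C i)) (\<lambda>i. target (C i))"
  "ident UC = ulift1 U (\<lambda>i. mors (C i)) (\<lambda>i. ident (C i))"
  "cmp UC = ulift2 U (\<lambda>i. mors (C i)) (\<lambda>i. cmp (C i))"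
  by (simp_all add: ultra_cat_def)

lemma ob_in: "ob X x \<Longrightarrow> X \<in> objs UC"
  by (simp add: objs_UC rep_in_ultraprod)

lemma ob_some_rep: "X \<in> objs UC \<Longrightarrow> ob X (some_rep X)"
  by (simp add: objs_UC rep_some_rep)

lemma mor_some_rep: "F \<in> mors UC \<Longrightarrow> mor F (some_rep F)"
  by (simp add: mors_UC rep_some_rep)

lemma rep_mor_nonempty:
  assumes "mor F f" shows "objs (C i) \<noteq> {}" "mors (C i) \<noteq> {}"
  using rep_nonempty[OF assms] mors_nonempty_iff by auto

lemma ob_nonempty:
  assumes "ob X x" shows "objs (C i) \<noteq> {}" "mors (C i) \<noteq> {}"
  using rep_nonempty[OF assms] mors_nonempty_iff by auto

lemma ob_source:
  assumes "mor F f"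
  shows "ob (source UC F) (\<lambda>i. source (C i) (f i))"
proof -
  have "\<forall>\<^sub>F i in U. source (C i) (f i) \<in> objs (C i)"
    using rep_eventually[OF assms] by eventually_elim (rule small_category.source_closed[OF small])
  then show ?thesis
    unfolding UC_simps by (rule rep_lift1[OF assms rep_mor_nonempty(1)[OF assms]])
qed

lemma ob_target:
  assumes "mor F f"
  shows "ob (target UC F) (\<lambda>i. target (C i) (f i))"
proof -
  have "\<forall>\<^sub>F i in U. target (C i) (f i) \<in> objs (C i)"
    using rep_eventually[OF assms] by eventually_elim (rule small_category.target_closed[OF small])
  then show ?thesis
    unfolding UC_simps by (rule rep_lift1[OF assms rep_mor_nonempty(1)[OF assms]])
qed

lemma in_homs_iff:
  assumes "mor F f" "ob X x" "ob Y y"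
  shows "F \<in> homs UC X Y \<longleftrightarrow> (\<forall>\<^sub>F i in U. f i \<in> homs (C i) (x i) (y i))"
  using rep_eventually[OF assms(1)] rep_in_ultraprod[OF assms(1)]
    rep_eq_iff[OF ob_source[OF assms(1)] assms(2)] rep_eq_iff[OF ob_target[OF assms(1)] assms(3)]
  by (simp add: homs_def mors_UC eventually_conj_iff)

lemma arrow_in_homs: "arrow F f x y \<Longrightarrow> ob X x \<Longrightarrow> ob Y y \<Longrightarrow> F \<in> homs UC X Y"
  using in_homs_iff by (auto simp: arrow_def)

lemma arrow_homs: "F \<in> homs UC X Y \<Longrightarrow> ob X x \<Longrightarrow> ob Y y \<Longrightarrow> arrow F (some_rep F) x y"
  using in_homs_iff[OF mor_some_rep, of F X x Y y] mor_some_rep[of F] unfolding arrow_def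
  by (simp add: homs_def)

lemma homs_ob:
  assumes "F \<in> homs UC X Y" shows "ob X (some_rep X)" "ob Y (some_rep Y)"
proof -
  have F: "F \<in> mors UC" and eq: "source UC F = X" "target UC F = Y"
    using assms by (auto simp: homs_def)
  show "ob X (some_rep X)" "ob Y (some_rep Y)"
    unfolding eq[symmetric]
    by (rule ob_some_rep[OF ob_in[OF ob_source[OF mor_some_rep[OF F]]]]
        ob_some_rep[OF ob_in[OF ob_target[OF mor_some_rep[OF F]]]])+
qed

lemma arrow_some_rep: "F \<in> homs UC X Y \<Longrightarrow> arrow F (some_rep F) (some_rep X) (some_rep Y)"
  by (rule arrow_homs[OF _ homs_ob])

lemma rep_arrow: "mor F f \<Longrightarrow>
    arrow F f (\<lambda>i. source (C i) (f i)) (\<lambda>i. target (C i) (f i))"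
  unfolding arrow_def homs_def by (simp add: rep_eventually)

text \<open>Typing rules for termwise operations of each arity. They require that no factor is empty, since an
  operation may take its arguments from sets other than the morphisms of the factors.\<close>

lemma arrow_lift1:
  assumes "\<And>i. objs (C i) \<noteq> {}" "rep U S X x"
    "\<forall>\<^sub>F i in U. p i (x i) \<in> homs (C i) (a i) (b i)"
  shows "arrow (ulift1 U (\<lambda>i. mors (C i)) p X) (\<lambda>i. p i (x i)) a b"
proof -
  have "\<forall>\<^sub>F i in U. p i (x i) \<in> mors (C i)"
    using assms(3) by eventually_elim (simp add: homs_def)
  then show ?thesis
    unfolding arrow_def using rep_lift1[OF assms(2), where p = p] assms(1,3) by (simp add: mors_nonempty_iff)
qed

lemma arrow_lift2:
  assumes "\<And>i. objs (C i) \<noteq> {}" "rep U S X x" "rep U S' Y y"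
    "\<forall>\<^sub>F i in U. p i (x i) (y i) \<in> homs (C i) (a i) (b i)"
  shows "arrow (ulift2 U (\<lambda>i. mors (C i)) p X Y) (\<lambda>i. p i (x i) (y i)) a b"
proof -
  have "\<forall>\<^sub>F i in U. p i (x i) (y i) \<in> mors (C i)"
    using assms(4) by eventually_elim (simp add: homs_def)
  then show ?thesis
    unfolding arrow_def using rep_lift2[OF assms(2,3), where p = p] assms(1,4) by (simp add: mors_nonempty_iff)
qed

lemma arrow_lift3:
  assumes "\<And>i. objs (C i) \<noteq> {}" "rep U S X x" "rep U S' Y y" "rep U S'' Z z"
    "\<forall>\<^sub>F i in U. p i (x i) (y i) (z i) \<in> homs (C i) (a i) (b i)"
  shows "arrow (ulift3 U (\<lambda>i. mors (C i)) p X Y Z) (\<lambda>i. p i (x i) (y i) (z i)) a b"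
proof -
  have "\<forall>\<^sub>F i in U. p i (x i) (y i) (z i) \<in> mors (C i)"
    using assms(5) by eventually_elim (simp add: homs_def)
  then show ?thesis
    unfolding arrow_def using rep_lift3[OF assms(2,3,4), where p = p] assms(1,5)
    by (simp add: mors_nonempty_iff)
qed

lemma arrow_ident:
  assumes "ob X x" shows "arrow (ident UC X) (\<lambda>i. ident (C i) (x i)) x x"
  unfolding UC_simps
proof (rule arrow_lift1[OF ob_nonempty(1)[OF assms] assms])
  show "\<forall>\<^sub>F i in U. ident (C i) (x i) \<in> homs (C i) (x i) (x i)"
    using rep_eventually[OF assms] by eventually_elim (rule small_category.ident_closed[OF small])
qed

lemma arrow_cmp:
  assumes f: "arrow F f x y" and g: "arrow G g y z"
  shows "arrow (cmp UC G F) (\<lambda>i. cmp (C i) (g i) (f i)) x z"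
  unfolding UC_simps
proof (rule arrow_lift2[OF rep_mor_nonempty(1)[OF arrow_rep[OF f]] arrow_rep[OF g] arrow_rep[OF f]])
  show "\<forall>\<^sub>F i in U. cmp (C i) (g i) (f i) \<in> homs (C i) (x i) (z i)"
    using arrow_eventually[OF f] arrow_eventually[OF g]
    by eventually_elim (rule small_category.cmp_closed[OF small])
qed

lemma some_rep_homs: "F \<in> homs UC X Y \<Longrightarrow>
    \<forall>\<^sub>F i in U. some_rep F i \<in> homs (C i) (some_rep X i) (some_rep Y i)"
  by (rule arrow_eventually[OF arrow_some_rep])

lemma some_rep_objs: "X \<in> objs UC \<Longrightarrow> \<forall>\<^sub>F i in U. some_rep X i \<in> objs (C i)"
  by (rule rep_eventually[OF ob_some_rep])

lemma arrow_class:
  assumes "\<And>i. objs (C i) \<noteq> {}" "\<forall>\<^sub>F i in U. f i \<in> homs (C i) (x i) (y i)"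
  shows "arrow (ultra_class U (\<lambda>i. mors (C i)) f) f x y"
proof -
  have "\<forall>\<^sub>F i in U. f i \<in> mors (C i)"
    using assms(2) by eventually_elim (simp add: homs_def)
  then show ?thesis using assms by (simp add: arrow_def rep_class mors_nonempty_iff)
qed

text \<open>Resolution with the typing rules, followed by the representatives of the variables of an axiom,
  derives \<open>arrow\<close> for both sides of the axiom and thereby computes their representatives.\<close>

lemmas cat_rules = arrow_cmp arrow_ident

lemma small_category_UC: "small_category UC"
proof
  show "source UC F \<in> objs UC" "target UC F \<in> objs UC" if "F \<in> mors UC" for F
    by (rule ob_in[OF ob_source[OF mor_some_rep[OF that]]] ob_in[OF ob_target[OF mor_some_rep[OF that]]])+
  show "ident UC X \<in> homs UC X X" if "X \<in> objs UC" for X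
    using ob_some_rep[OF that] by (intro arrow_in_homs[OF arrow_ident])
  show "cmp UC G F \<in> homs UC X Z" if "F \<in> homs UC X Y" "G \<in> homs UC Y Z" for F G X Y Z
    by (rule arrow_in_homs[OF arrow_cmp[OF that[THEN arrow_some_rep]] homs_ob(1)[OF that(1)]
          homs_ob(2)[OF that(2)]])
  show "cmp UC F (ident UC X) = F" if h: "F \<in> homs UC X Y" for F X Y
    by (rule arrow_eqI, (rule cat_rules h[THEN arrow_some_rep] h[THEN homs_ob(1)] h[THEN homs_ob(2)])+,
        use h[THEN some_rep_homs] in eventually_elim,
        rule small_category.cmp_ident[OF small])
  show "cmp UC (ident UC Y) F = F" if h: "F \<in> homs UC X Y" for F X Y
    by (rule arrow_eqI, (rule cat_rules h[THEN arrow_some_rep] h[THEN homs_ob(1)] h[THEN homs_ob(2)])+,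
        use h[THEN some_rep_homs] in eventually_elim,
        rule small_category.ident_cmp[OF small])
  show "cmp UC (cmp UC H G) F = cmp UC H (cmp UC G F)"
    if h: "F \<in> homs UC W X" "G \<in> homs UC X Y" "H \<in> homs UC Y Z" for F G H W X Y Z
    by (rule arrow_eqI, (rule cat_rules h[THEN arrow_some_rep] h[THEN homs_ob(1)] h[THEN homs_ob(2)])+,
        use h[THEN some_rep_homs] in eventually_elim,
        rule small_category.cmp_assoc[OF small])
qed

lemma idempotent_complete_UC:
  assumes "\<forall>\<^sub>F i in U. idempotent_complete (C i)"
  shows "idempotent_complete UC"
  unfolding idempotent_complete_def
proof (intro ballI impI)
  fix X E
  assume X: "X \<in> objs UC" and E: "E \<in> homs UC X X" and idem: "cmp UC E E = E"
  have "\<forall>\<^sub>F i in U. cmp (C i) (some_rep E i) (some_rep E i) = some_rep E i"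
    using idem rep_eq_iff[OF arrow_rep[OF arrow_cmp] arrow_rep,
        OF arrow_some_rep arrow_some_rep arrow_some_rep, OF E E E] by simp
  then have "\<forall>\<^sub>F i in U. \<exists>y r s. y \<in> objs (C i) \<and> r \<in> homs (C i) (some_rep X i) y \<and>
      s \<in> homs (C i) y (some_rep X i) \<and> cmp (C i) r s = ident (C i) y \<and> cmp (C i) s r = some_rep E i"
    using assms some_rep_objs[OF X] some_rep_homs[OF E]
    by eventually_elim (unfold idempotent_complete_def, blast)
  then obtain y r s where ev: "\<forall>\<^sub>F i in U. y i \<in> objs (C i) \<and> r i \<in> homs (C i) (some_rep X i) (y i) \<and>
      s i \<in> homs (C i) (y i) (some_rep X i) \<and> cmp (C i) (r i) (s i) = ident (C i) (y i) \<and>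
      cmp (C i) (s i) (r i) = some_rep E i"
    unfolding eventually_ex by blast
  note ev = ev[unfolded eventually_conj_iff]
  have ne: "objs (C i) \<noteq> {}" for i by (rule ob_nonempty[OF ob_some_rep[OF X]])
  have Y: "ob (ultra_class U (\<lambda>i. objs (C i)) y) y" (is "ob ?Y y")
    using ev ne by (intro rep_class) simp_all
  have R: "arrow (ultra_class U (\<lambda>i. mors (C i)) r) r (some_rep X) y" (is "arrow ?R _ _ _")
    using ev ne by (intro arrow_class) simp_all
  have S: "arrow (ultra_class U (\<lambda>i. mors (C i)) s) s y (some_rep X)" (is "arrow ?S _ _ _")
    using ev ne by (intro arrow_class) simp_all
  show "\<exists>Y\<in>objs UC. \<exists>R\<in>homs UC X Y. \<exists>S\<in>homs UC Y X. cmp UC R S = ident UC Y \<and> cmp UC S R = E"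
  proof (intro bexI conjI)
    show "cmp UC ?R ?S = ident UC ?Y"
      by (rule arrow_eqI[OF arrow_cmp[OF S R] arrow_ident[OF Y]]) (use ev in simp)
    show "cmp UC ?S ?R = E"
      by (rule arrow_eqI[OF arrow_cmp[OF R S] arrow_some_rep[OF E]]) (use ev in simp)
    show "?S \<in> homs UC ?Y X" by (rule arrow_in_homs[OF S Y ob_some_rep[OF X]])
    show "?R \<in> homs UC X ?Y" by (rule arrow_in_homs[OF R ob_some_rep[OF X] Y])
    show "?Y \<in> objs UC" by (rule ob_in[OF Y])
  qed
qed

lemma inverse_mors_UC:
  assumes F: "arrow F f x y" and G: "arrow G g y x" and X: "ob X x" and Y: "ob Y y"
    and inv: "\<forall>\<^sub>F i in U. inverse_mors (C i) (f i) (g i)"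
  shows "inverse_mors UC F G"
proof -
  have FG: "F \<in> homs UC X Y" "G \<in> homs UC Y X"
    using arrow_in_homs F G X Y by blast+
  have "\<forall>\<^sub>F i in U. cmp (C i) (g i) (f i) = ident (C i) (x i)"
    "\<forall>\<^sub>F i in U. cmp (C i) (f i) (g i) = ident (C i) (y i)"
    using inv arrow_eventually[OF F] by (eventually_elim, simp add: inverse_mors_def homs_def)+
  then have "cmp UC G F = ident UC X" "cmp UC F G = ident UC Y"
    using arrow_eqI[OF arrow_cmp[OF F G] arrow_ident[OF X]]
      arrow_eqI[OF arrow_cmp[OF G F] arrow_ident[OF Y]] by simp_all
  then show ?thesis using FG by (simp add: inverse_mors_def homs_def)
qed

end

lemma (in small_category) homs_source: "f \<in> homs C X Y \<Longrightarrow> X \<in> objs C"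
  and homs_target: "f \<in> homs C X Y \<Longrightarrow> Y \<in> objs C"
  using source_closed target_closed by (auto simp: homs_def)

lemma (in small_category) inverse_mors_unique:
  assumes g: "inverse_mors C f g" and h: "inverse_mors C f h"
  shows "g = h"
proof -
  have f: "f \<in> homs C (source C f) (target C f)" using g by (simp add: inverse_mors_def homs_def)
  have gh: "g \<in> homs C (target C f) (source C f)" "h \<in> homs C (target C f) (source C f)"
    using g h by (simp_all add: inverse_mors_def)
  have "g = g \<cdot> (f \<cdot> h)" using cmp_ident[OF gh(1)] h by (simp add: inverse_mors_def)
  also have "\<dots> = (g \<cdot> f) \<cdot> h" by (rule cmp_assoc[OF gh(2) f gh(1), symmetric])
  also have "\<dots> = h" using ident_cmp[OF gh(2)] g by (simp add: inverse_mors_def)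
  finally show ?thesis .
qed

lemma (in small_category) inv_mor_eq: "inverse_mors C f g \<Longrightarrow> inv_mor C f = g"
  unfolding inv_mor_def by (rule the_equality) (auto intro: inverse_mors_unique)

lemma (in small_category) inverse_mors_inv_mor:
  assumes "f \<in> isos C X Y" shows "inverse_mors C f (inv_mor C f)"
  using assms inv_mor_eq by (auto simp: isos_def)

context category_family
begin

text \<open>The termwise inverse represents the inverse; hence inverses of structural isomorphisms may occur in
  the axioms that are transferred.\<close>

lemma
  assumes F: "arrow F f x y" and X: "ob X x" and Y: "ob Y y"
    and iso: "\<forall>\<^sub>F i in U. f i \<in> isos (C i) (x i) (y i)"
  shows isos_UC: "F \<in> isos UC X Y"
    and arrow_inv_mor: "arrow (inv_mor UC F) (\<lambda>i. inv_mor (C i) (f i)) y x"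
proof -
  let ?g = "\<lambda>i. inv_mor (C i) (f i)"
  let ?G = "ultra_class U (\<lambda>i. mors (C i)) ?g"
  have inv: "\<forall>\<^sub>F i in U. inverse_mors (C i) (f i) (?g i)"
    using iso by eventually_elim (rule small_category.inverse_mors_inv_mor[OF small])
  have "\<forall>\<^sub>F i in U. ?g i \<in> homs (C i) (y i) (x i)"
    using inv iso by eventually_elim (simp add: inverse_mors_def isos_def homs_def)
  then have G: "arrow ?G ?g y x" by (rule arrow_class[OF ob_nonempty(1)[OF X]])
  have *: "inverse_mors UC F ?G" by (rule inverse_mors_UC[OF F G X Y inv])
  then show "F \<in> isos UC X Y" using arrow_in_homs[OF F X Y] by (auto simp: isos_def)
  show "arrow (inv_mor UC F) ?g y x"
    using G small_category.inv_mor_eq[OF small_category_UC *] by simp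
qed

end


section \<open>Monoidal, rigid, braided and symmetric ultraproducts\<close>

text \<open>A sequence of categories of which almost every one is monoidal. No factor may be without objects,
  as the unit object of the ultraproduct is a class of objects.\<close>

locale monoidal_family = category_family U C
  for U :: "'i filter" and C :: "'i \<Rightarrow> ('o, 'm) category" +
  fixes M :: "'i \<Rightarrow> ('o, 'm) monoidal_data"
  assumes ne: "objs (C i) \<noteq> {}"
    and mon: "\<forall>\<^sub>F i in U. monoidal_category (C i) (M i)"
begin

abbreviation UM where "UM \<equiv> ultra_monoidal U C M"

lemma UM_simps:
  "tens UM = ulift2 U (\<lambda>i. objs (C i)) (\<lambda>i. tens (M i))"
  "tens_mor UM = ulift2 U (\<lambda>i. mors (C i)) (\<lambda>i. tens_mor (M i))"
  "tens_unit UM = ultra_class U (\<lambda>i. objs (C i)) (\<lambda>i. tens_unit (M i))"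
  "associator UM = ulift3 U (\<lambda>i. mors (C i)) (\<lambda>i. associator (M i))"
  "left_unitor UM = ulift1 U (\<lambda>i. mors (C i)) (\<lambda>i. left_unitor (M i))"
  "right_unitor UM = ulift1 U (\<lambda>i. mors (C i)) (\<lambda>i. right_unitor (M i))"
  by (simp_all add: ultra_monoidal_def)

lemma ob_tens:
  assumes "ob X x" "ob Y y"
  shows "ob (tens UM X Y) (\<lambda>i. tens (M i) (x i) (y i))"
  unfolding UM_simps
  by (rule rep_lift2[OF assms ne], use mon assms[THEN rep_eventually] in eventually_elim,
      rule monoidal_category.tens_closed)

lemma ob_unit: "ob (tens_unit UM) (\<lambda>i. tens_unit (M i))"
  unfolding UM_simps
  by (rule rep_class[OF ne], use mon in eventually_elim, rule monoidal_category.tens_unit_closed)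

lemma arrow_tens:
  assumes "arrow F f x x'" "arrow G g y y'"
  shows "arrow (tens_mor UM F G) (\<lambda>i. tens_mor (M i) (f i) (g i))
    (\<lambda>i. tens (M i) (x i) (y i)) (\<lambda>i. tens (M i) (x' i) (y' i))"
  unfolding UM_simps
  by (rule arrow_lift2[OF ne assms[THEN arrow_rep]], use mon assms[THEN arrow_eventually] in eventually_elim,
      rule monoidal_category.tens_mor_closed)

lemma
  assumes "ob X x" "ob Y y" "ob Z z"
  shows arrow_associator: "arrow (associator UM X Y Z) (\<lambda>i. associator (M i) (x i) (y i) (z i))
      (\<lambda>i. tens (M i) (tens (M i) (x i) (y i)) (z i)) (\<lambda>i. tens (M i) (x i) (tens (M i) (y i) (z i)))"
      (is ?arrow)
    and associator_UC_iso: "associator UM X Y Z \<in>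
      isos UC (tens UM (tens UM X Y) Z) (tens UM X (tens UM Y Z))"
    and arrow_inv_associator: "arrow (inv_mor UC (associator UM X Y Z))
      (\<lambda>i. inv_mor (C i) (associator (M i) (x i) (y i) (z i)))
      (\<lambda>i. tens (M i) (x i) (tens (M i) (y i) (z i))) (\<lambda>i. tens (M i) (tens (M i) (x i) (y i)) (z i))"
proof -
  have iso: "\<forall>\<^sub>F i in U. associator (M i) (x i) (y i) (z i) \<in> isos (C i)
      (tens (M i) (tens (M i) (x i) (y i)) (z i)) (tens (M i) (x i) (tens (M i) (y i) (z i)))"
    using mon assms[THEN rep_eventually] by eventually_elim (rule monoidal_category.associator_iso)
  show arrow: ?arrow
    unfolding UM_simps by (rule arrow_lift3[OF ne assms], use iso in eventually_elim, rule homs_if_isos)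
  show "associator UM X Y Z \<in> isos UC (tens UM (tens UM X Y) Z) (tens UM X (tens UM Y Z))"
    by (rule isos_UC[OF arrow _ _ iso]; (rule ob_tens assms)+)
  show "arrow (inv_mor UC (associator UM X Y Z))
      (\<lambda>i. inv_mor (C i) (associator (M i) (x i) (y i) (z i)))
      (\<lambda>i. tens (M i) (x i) (tens (M i) (y i) (z i))) (\<lambda>i. tens (M i) (tens (M i) (x i) (y i)) (z i))"
    by (rule arrow_inv_mor[OF arrow _ _ iso]; (rule ob_tens assms)+)
qed

lemma
  assumes "ob X x"
  shows arrow_left_unitor: "arrow (left_unitor UM X) (\<lambda>i. left_unitor (M i) (x i))
      (\<lambda>i. tens (M i) (tens_unit (M i)) (x i)) x" (is ?arrow)
    and left_unitor_UC_iso: "left_unitor UM X \<in> isos UC (tens UM (tens_unit UM) X) X"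
    and arrow_inv_left_unitor: "arrow (inv_mor UC (left_unitor UM X))
      (\<lambda>i. inv_mor (C i) (left_unitor (M i) (x i))) x (\<lambda>i. tens (M i) (tens_unit (M i)) (x i))"
proof -
  have iso: "\<forall>\<^sub>F i in U. left_unitor (M i) (x i) \<in> isos (C i) (tens (M i) (tens_unit (M i)) (x i)) (x i)"
    using mon rep_eventually[OF assms] by eventually_elim (rule monoidal_category.left_unitor_iso)
  show arrow: ?arrow
    unfolding UM_simps by (rule arrow_lift1[OF ne assms], use iso in eventually_elim, rule homs_if_isos)
  show "left_unitor UM X \<in> isos UC (tens UM (tens_unit UM) X) X"
    by (rule isos_UC[OF arrow _ _ iso]; (rule ob_tens ob_unit assms)+)
  show "arrow (inv_mor UC (left_unitor UM X))
      (\<lambda>i. inv_mor (C i) (left_unitor (M i) (x i))) x (\<lambda>i. tens (M i) (tens_unit (M i)) (x i))"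
    by (rule arrow_inv_mor[OF arrow _ _ iso]; (rule ob_tens ob_unit assms)+)
qed

lemma
  assumes "ob X x"
  shows arrow_right_unitor: "arrow (right_unitor UM X) (\<lambda>i. right_unitor (M i) (x i))
      (\<lambda>i. tens (M i) (x i) (tens_unit (M i))) x" (is ?arrow)
    and right_unitor_UC_iso: "right_unitor UM X \<in> isos UC (tens UM X (tens_unit UM)) X"
    and arrow_inv_right_unitor: "arrow (inv_mor UC (right_unitor UM X))
      (\<lambda>i. inv_mor (C i) (right_unitor (M i) (x i))) x (\<lambda>i. tens (M i) (x i) (tens_unit (M i)))"
proof -
  have iso: "\<forall>\<^sub>F i in U. right_unitor (M i) (x i) \<in> isos (C i) (tens (M i) (x i) (tens_unit (M i))) (x i)"
    using mon rep_eventually[OF assms] by eventually_elim (rule monoidal_category.right_unitor_iso)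
  show arrow: ?arrow
    unfolding UM_simps by (rule arrow_lift1[OF ne assms], use iso in eventually_elim, rule homs_if_isos)
  show "right_unitor UM X \<in> isos UC (tens UM X (tens_unit UM)) X"
    by (rule isos_UC[OF arrow _ _ iso]; (rule ob_tens ob_unit assms)+)
  show "arrow (inv_mor UC (right_unitor UM X))
      (\<lambda>i. inv_mor (C i) (right_unitor (M i) (x i))) x (\<lambda>i. tens (M i) (x i) (tens_unit (M i)))"
    by (rule arrow_inv_mor[OF arrow _ _ iso]; (rule ob_tens ob_unit assms)+)
qed

lemmas monoidal_rules = arrow_cmp arrow_ident arrow_tens arrow_associator arrow_left_unitor arrow_right_unitor
  arrow_inv_associator arrow_inv_left_unitor arrow_inv_right_unitor ob_tens ob_unit

lemma monoidal_category_UC: "monoidal_category UC UM"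
proof -
  interpret UC: small_category UC by (rule small_category_UC)
  show ?thesis
  proof
    show "tens UM X Y \<in> objs UC" if h: "X \<in> objs UC" "Y \<in> objs UC" for X Y
      by (rule ob_in[OF ob_tens[OF h[THEN ob_some_rep]]])
    show "tens_mor UM F G \<in> homs UC (tens UM X Y) (tens UM X' Y')"
      if h: "F \<in> homs UC X X'" "G \<in> homs UC Y Y'" for F G X X' Y Y'
      by (rule arrow_in_homs; (rule monoidal_rules h[THEN arrow_some_rep] h[THEN homs_ob(1)] h[THEN homs_ob(2)])+)
    show "tens_mor UM (ident UC X) (ident UC Y) = ident UC (tens UM X Y)"
      if h: "X \<in> objs UC" "Y \<in> objs UC" for X Y
      by (rule arrow_eqI, (rule monoidal_rules h[THEN ob_some_rep])+,
          use mon h[THEN some_rep_objs] in eventually_elim,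
          rule monoidal_category.tens_ident)
    show "tens_mor UM (cmp UC F' F) (cmp UC G' G) = cmp UC (tens_mor UM F' G') (tens_mor UM F G)"
      if h: "F \<in> homs UC X X'" "F' \<in> homs UC X' X''" "G \<in> homs UC Y Y'" "G' \<in> homs UC Y' Y''"
      for F F' G G' X X' X'' Y Y' Y''
      by (rule arrow_eqI, (rule monoidal_rules h[THEN arrow_some_rep])+,
          use mon h[THEN some_rep_homs] in eventually_elim,
          rule monoidal_category.tens_cmp)
    show "tens_unit UM \<in> objs UC"
      by (rule ob_in[OF ob_unit])
    show "associator UM X Y Z \<in> isos UC (tens UM (tens UM X Y) Z) (tens UM X (tens UM Y Z))"
      if h: "X \<in> objs UC" "Y \<in> objs UC" "Z \<in> objs UC" for X Y Z
      by (rule associator_UC_iso[OF h[THEN ob_some_rep]])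
    show "cmp UC (associator UM X' Y' Z') (tens_mor UM (tens_mor UM F G) H) =
        cmp UC (tens_mor UM F (tens_mor UM G H)) (associator UM X Y Z)"
      if h: "F \<in> homs UC X X'" "G \<in> homs UC Y Y'" "H \<in> homs UC Z Z'" for F G H X X' Y Y' Z Z'
      by (rule arrow_eqI, (rule monoidal_rules h[THEN arrow_some_rep] h[THEN homs_ob(1)] h[THEN homs_ob(2)])+,
          use mon h[THEN some_rep_homs] in eventually_elim, rule monoidal_category.associator_natural)
    show "left_unitor UM X \<in> isos UC (tens UM (tens_unit UM) X) X" if h: "X \<in> objs UC" for X
      by (rule left_unitor_UC_iso[OF ob_some_rep[OF h]])
    show "cmp UC (left_unitor UM X') (tens_mor UM (ident UC (tens_unit UM)) F) =
        cmp UC F (left_unitor UM X)"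
      if h: "F \<in> homs UC X X'" for F X X'
      by (rule arrow_eqI, (rule monoidal_rules h[THEN arrow_some_rep] h[THEN homs_ob(1)] h[THEN homs_ob(2)])+,
          use mon h[THEN some_rep_homs] in eventually_elim, rule monoidal_category.left_unitor_natural)
    show "right_unitor UM X \<in> isos UC (tens UM X (tens_unit UM)) X" if h: "X \<in> objs UC" for X
      by (rule right_unitor_UC_iso[OF ob_some_rep[OF h]])
    show "cmp UC (right_unitor UM X') (tens_mor UM F (ident UC (tens_unit UM))) =
        cmp UC F (right_unitor UM X)"
      if h: "F \<in> homs UC X X'" for F X X'
      by (rule arrow_eqI, (rule monoidal_rules h[THEN arrow_some_rep] h[THEN homs_ob(1)] h[THEN homs_ob(2)])+,
          use mon h[THEN some_rep_homs] in eventually_elim, rule monoidal_category.right_unitor_natural)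
    show "cmp UC (tens_mor UM (ident UC W) (associator UM X Y Z))
          (cmp UC (associator UM W (tens UM X Y) Z) (tens_mor UM (associator UM W X Y) (ident UC Z))) =
        cmp UC (associator UM W X (tens UM Y Z)) (associator UM (tens UM W X) Y Z)"
      if h: "W \<in> objs UC" "X \<in> objs UC" "Y \<in> objs UC" "Z \<in> objs UC" for W X Y Z
      by (rule arrow_eqI, (rule monoidal_rules h[THEN ob_some_rep])+,
          use mon h[THEN some_rep_objs] in eventually_elim,
          rule monoidal_category.pentagon)
    show "cmp UC (tens_mor UM (ident UC X) (left_unitor UM Y)) (associator UM X (tens_unit UM) Y) =
        tens_mor UM (right_unitor UM X) (ident UC Y)"
      if h: "X \<in> objs UC" "Y \<in> objs UC" for X Y
      by (rule arrow_eqI, (rule monoidal_rules h[THEN ob_some_rep])+,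
          use mon h[THEN some_rep_objs] in eventually_elim,
          rule monoidal_category.triangle)
  qed
qed

lemma is_dual_UC:
  assumes X: "ob X x" and Y: "ob Y y"
    and E: "mor E e" and D: "mor D d"
    and dual: "\<forall>\<^sub>F i in U. is_dual (C i) (M i) (x i) (y i) (e i) (d i)"
  shows "is_dual UC UM X Y E D"
proof -
  note dual = dual[unfolded is_dual_def eventually_conj_iff]
  have arrow: "arrow E e (\<lambda>i. tens (M i) (y i) (x i)) (\<lambda>i. tens_unit (M i))"
    "arrow D d (\<lambda>i. tens_unit (M i)) (\<lambda>i. tens (M i) (x i) (y i))"
    using dual E D by (simp_all add: arrow_def)
  have "E \<in> homs UC (tens UM Y X) (tens_unit UM)" "D \<in> homs UC (tens_unit UM) (tens UM X Y)"
    by (rule arrow_in_homs[OF arrow(1)] arrow_in_homs[OF arrow(2)] ob_tens ob_unit X Y)+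
  moreover have "cmp UC (right_unitor UM X) (cmp UC (tens_mor UM (ident UC X) E)
      (cmp UC (associator UM X Y X) (cmp UC (tens_mor UM D (ident UC X))
        (inv_mor UC (left_unitor UM X))))) = ident UC X"
    by (rule arrow_eqI, (rule monoidal_rules arrow X Y)+) (use dual in blast)
  moreover have "cmp UC (left_unitor UM Y) (cmp UC (tens_mor UM E (ident UC Y))
      (cmp UC (inv_mor UC (associator UM Y X Y)) (cmp UC (tens_mor UM (ident UC Y) D)
        (inv_mor UC (right_unitor UM Y))))) = ident UC Y"
    by (rule arrow_eqI, (rule monoidal_rules arrow X Y)+) (use dual in blast)
  ultimately show ?thesis
    using ob_in[OF X] ob_in[OF Y] by (simp add: is_dual_def)
qed

lemma is_dual_class:
  assumes "\<forall>\<^sub>F i in U. is_dual (C i) (M i) (x i) (y i) (e i) (d i)"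
  shows "is_dual UC UM (ultra_class U (\<lambda>i. objs (C i)) x) (ultra_class U (\<lambda>i. objs (C i)) y)
    (ultra_class U (\<lambda>i. mors (C i)) e) (ultra_class U (\<lambda>i. mors (C i)) d)"
proof -
  have ev: "\<forall>\<^sub>F i in U. x i \<in> objs (C i)" "\<forall>\<^sub>F i in U. y i \<in> objs (C i)"
    "\<forall>\<^sub>F i in U. e i \<in> mors (C i)" "\<forall>\<^sub>F i in U. d i \<in> mors (C i)"
    using assms by (eventually_elim, simp add: is_dual_def homs_def)+
  have ne': "mors (C i) \<noteq> {}" for i using ne mors_nonempty_iff by blast
  show ?thesis
    by (rule is_dual_UC[OF rep_class[OF ne ev(1)] rep_class[OF ne ev(2)]
          rep_class[OF ne' ev(3)] rep_class[OF ne' ev(4)] assms])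
qed

lemma rigid_category_UC:
  assumes rig: "\<forall>\<^sub>F i in U. rigid_category (C i) (M i)"
  shows "rigid_category UC UM"
proof -
  interpret UC: monoidal_category UC UM by (rule monoidal_category_UC)
  show ?thesis
  proof
    fix X assume X: "X \<in> objs UC"
    \<comment> \<open>\<open>X\<close> is the class of its representative, as \<open>is_dual_class\<close> speaks of classes of sequences.\<close>
    note XX = ob_some_rep[OF X, unfolded rep_def, THEN conjunct1]
    have "\<forall>\<^sub>F i in U. \<exists>y e d. is_dual (C i) (M i) (some_rep X i) y e d"
      using rig some_rep_objs[OF X] by eventually_elim (rule rigid_category.left_dual)
    then obtain y e d where "\<forall>\<^sub>F i in U. is_dual (C i) (M i) (some_rep X i) (y i) (e i) (d i)"
      unfolding eventually_ex by blast
    from is_dual_class[OF this] show "\<exists>Y E D. is_dual UC UM X Y E D"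
      unfolding XX[symmetric] by blast
    have "\<forall>\<^sub>F i in U. \<exists>y e d. is_dual (C i) (M i) y (some_rep X i) e d"
      using rig some_rep_objs[OF X] by eventually_elim (rule rigid_category.right_dual)
    then obtain y e d where "\<forall>\<^sub>F i in U. is_dual (C i) (M i) (y i) (some_rep X i) (e i) (d i)"
      unfolding eventually_ex by blast
    from is_dual_class[OF this] show "\<exists>Y E D. is_dual UC UM Y X E D"
      unfolding XX[symmetric] by blast
  qed
qed

end

text \<open>A sequence of categories of which almost every one carries a braiding.\<close>

locale braided_family = monoidal_family U C M
  for U :: "'i filter" and C :: "'i \<Rightarrow> ('o, 'm) category" and M :: "'i \<Rightarrow> ('o, 'm) monoidal_data" +
  fixes c :: "'i \<Rightarrow> 'o \<Rightarrow> 'o \<Rightarrow> 'm"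
  assumes braided: "\<forall>\<^sub>F i in U. braided_category (C i) (M i) (c i)"
begin

abbreviation Uc where "Uc \<equiv> ultra_braid U C c"

lemma
  assumes "ob X x" "ob Y y"
  shows arrow_braid: "arrow (Uc X Y) (\<lambda>i. c i (x i) (y i))
      (\<lambda>i. tens (M i) (x i) (y i)) (\<lambda>i. tens (M i) (y i) (x i))" (is ?arrow)
    and braid_UC_iso: "Uc X Y \<in> isos UC (tens UM X Y) (tens UM Y X)"
proof -
  have iso: "\<forall>\<^sub>F i in U. c i (x i) (y i) \<in>
      isos (C i) (tens (M i) (x i) (y i)) (tens (M i) (y i) (x i))"
    using braided assms[THEN rep_eventually] by eventually_elim (rule braided_category.braid_iso)
  show arrow: ?arrow
    unfolding ultra_braid_def
    by (rule arrow_lift2[OF ne assms], use iso in eventually_elim, rule homs_if_isos)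
  show "Uc X Y \<in> isos UC (tens UM X Y) (tens UM Y X)"
    by (rule isos_UC[OF arrow _ _ iso]; rule ob_tens; rule assms)
qed

lemma braided_category_UC: "braided_category UC UM Uc"
proof -
  interpret UC: monoidal_category UC UM by (rule monoidal_category_UC)
  show ?thesis
  proof
    show "Uc X Y \<in> isos UC (tens UM X Y) (tens UM Y X)" if h: "X \<in> objs UC" "Y \<in> objs UC" for X Y
      by (rule braid_UC_iso[OF h[THEN ob_some_rep]])
    show "cmp UC (Uc X' Y') (tens_mor UM F G) = cmp UC (tens_mor UM G F) (Uc X Y)"
      if h: "F \<in> homs UC X X'" "G \<in> homs UC Y Y'" for F G X X' Y Y'
      by (rule arrow_eqI, (rule monoidal_rules arrow_braid h[THEN arrow_some_rep] h[THEN homs_ob(1)] h[THEN homs_ob(2)])+,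
          use braided h[THEN some_rep_homs] in eventually_elim, rule braided_category.braid_natural)
    show "cmp UC (associator UM Y Z X) (cmp UC (Uc X (tens UM Y Z)) (associator UM X Y Z)) =
        cmp UC (tens_mor UM (ident UC Y) (Uc X Z))
          (cmp UC (associator UM Y X Z) (tens_mor UM (Uc X Y) (ident UC Z)))"
      if h: "X \<in> objs UC" "Y \<in> objs UC" "Z \<in> objs UC" for X Y Z
      by (rule arrow_eqI, (rule monoidal_rules arrow_braid h[THEN ob_some_rep])+,
          use braided h[THEN some_rep_objs] in eventually_elim, rule braided_category.hexagon1)
    show "cmp UC (inv_mor UC (associator UM Z X Y))
          (cmp UC (Uc (tens UM X Y) Z) (inv_mor UC (associator UM X Y Z))) =
        cmp UC (tens_mor UM (Uc X Z) (ident UC Y))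
          (cmp UC (inv_mor UC (associator UM X Z Y)) (tens_mor UM (ident UC X) (Uc Y Z)))"
      if h: "X \<in> objs UC" "Y \<in> objs UC" "Z \<in> objs UC" for X Y Z
      by (rule arrow_eqI, (rule monoidal_rules arrow_braid h[THEN ob_some_rep])+,
          use braided h[THEN some_rep_objs] in eventually_elim, rule braided_category.hexagon2)
  qed
qed

lemma symmetric_category_UC:
  assumes sym: "\<forall>\<^sub>F i in U. symmetric_category (C i) (M i) (c i)"
  shows "symmetric_category UC UM Uc"
proof -
  interpret UC: braided_category UC UM Uc by (rule braided_category_UC)
  show ?thesis
  proof
    show "cmp UC (Uc Y X) (Uc X Y) = ident UC (tens UM X Y)"
      if h: "X \<in> objs UC" "Y \<in> objs UC" for X Y
      by (rule arrow_eqI, (rule monoidal_rules arrow_braid h[THEN ob_some_rep])+,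
          use sym h[THEN some_rep_objs] in eventually_elim, rule symmetric_category.braid_symmetric)
  qed
qed

end

section \<open>Additive and abelian ultraproducts\<close>

context category_family
begin

text \<open>Unique existence of a morphism with a property \<open>Q\<close> that can be tested almost everywhere on
  representatives. Existence comes from a sequence of witnesses, uniqueness from the
  comparison of two solutions at almost every index.\<close>

lemma ex1_homs_UC:
  assumes X: "ob X x" and Y: "ob Y y"
    and Q: "\<And>H h. arrow H h x y \<Longrightarrow> Q H \<longleftrightarrow> (\<forall>\<^sub>F i in U. P i (h i))"
    and ex1: "\<forall>\<^sub>F i in U. \<exists>!h. h \<in> homs (C i) (x i) (y i) \<and> P i h"
  shows "\<exists>!H. H \<in> homs UC X Y \<and> Q H"
proof -
  have "\<forall>\<^sub>F i in U. \<exists>h. h \<in> homs (C i) (x i) (y i) \<and> P i h"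
    using ex1 by eventually_elim blast
  then obtain h where h: "\<forall>\<^sub>F i in U. h i \<in> homs (C i) (x i) (y i)" "\<forall>\<^sub>F i in U. P i (h i)"
    unfolding eventually_ex eventually_conj_iff by blast
  have arrow: "arrow (ultra_class U (\<lambda>i. mors (C i)) h) h x y"
    by (rule arrow_class[OF ob_nonempty(1)[OF X] h(1)])
  show ?thesis
  proof (rule ex_ex1I)
    show "\<exists>H. H \<in> homs UC X Y \<and> Q H"
      using arrow_in_homs[OF arrow X Y] Q[OF arrow] h(2) by blast
    fix H H' assume "H \<in> homs UC X Y \<and> Q H" "H' \<in> homs UC X Y \<and> Q H'"
    then have H: "arrow H (some_rep H) x y" "arrow H' (some_rep H') x y" and QH: "Q H" "Q H'"
      using arrow_homs[OF _ X Y] by blast+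
    show "H = H'"
    proof (rule arrow_eqI[OF H])
      show "\<forall>\<^sub>F i in U. some_rep H i = some_rep H' i"
        using ex1 QH[unfolded Q[OF H(1)] Q[OF H(2)]] H[THEN arrow_eventually]
        by eventually_elim blast
    qed
  qed
qed

lemma zero_object_UC:
  assumes Z: "ob Z z" and zero: "\<forall>\<^sub>F i in U. zero_object (C i) (z i)"
  shows "zero_object UC Z"
  unfolding zero_object_def
proof (intro conjI ballI)
  show "Z \<in> objs UC" by (rule ob_in[OF Z])
next
  fix X assume X: "X \<in> objs UC"
  \<comment> \<open>The trivial property \<open>True\<close> puts unique existence into the shape of \<open>ex1_homs_UC\<close>.\<close>
  have "\<forall>\<^sub>F i in U. \<exists>!f. f \<in> homs (C i) (some_rep X i) (z i) \<and> True"
    "\<forall>\<^sub>F i in U. \<exists>!f. f \<in> homs (C i) (z i) (some_rep X i) \<and> True"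
    using zero some_rep_objs[OF X] by (eventually_elim, simp add: zero_object_def)+
  from ex1_homs_UC[OF ob_some_rep[OF X] Z _ this(1), of "\<lambda>_. True"]
    ex1_homs_UC[OF Z ob_some_rep[OF X] _ this(2), of "\<lambda>_. True"]
  show "\<exists>!f. f \<in> homs UC X Z" "\<exists>!f. f \<in> homs UC Z X" by simp_all
qed

text \<open>If almost every \<open>f i\<close> failed to be monic, a sequence of pairs of distinct morphisms that it
  equalizes would give such a pair in the ultraproduct. Being non-monic for almost every \<open>i\<close> is the
  negation of being monic for almost every \<open>i\<close> because the filter is an ultrafilter.\<close>

lemma eventually_is_mono:
  assumes F: "mor F f" and mono: "is_mono UC F"
  shows "\<forall>\<^sub>F i in U. is_mono (C i) (f i)"
proof (rule ccontr)
  let ?s = "\<lambda>i. source (C i) (f i)"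
  assume "\<not> (\<forall>\<^sub>F i in U. is_mono (C i) (f i))"
  then have "\<forall>\<^sub>F i in U. \<not> is_mono (C i) (f i)" by (simp add: eventually_not_iff)
  then have "\<forall>\<^sub>F i in U. \<exists>w g h. g \<in> homs (C i) w (?s i) \<and> h \<in> homs (C i) w (?s i) \<and>
      cmp (C i) (f i) g = cmp (C i) (f i) h \<and> g \<noteq> h"
    using rep_eventually[OF F] by eventually_elim (unfold is_mono_def, blast)
  then obtain w g h where ev: "\<forall>\<^sub>F i in U. g i \<in> homs (C i) (w i) (?s i)"
    "\<forall>\<^sub>F i in U. h i \<in> homs (C i) (w i) (?s i)"
    "\<forall>\<^sub>F i in U. cmp (C i) (f i) (g i) = cmp (C i) (f i) (h i)" "\<forall>\<^sub>F i in U. g i \<noteq> h i"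
    unfolding eventually_ex eventually_conj_iff by blast
  note gh = arrow_class[OF rep_mor_nonempty(1)[OF F] ev(1)] arrow_class[OF rep_mor_nonempty(1)[OF F] ev(2)]
  have "\<forall>\<^sub>F i in U. w i \<in> objs (C i)"
    using ev(1) by eventually_elim (rule small_category.homs_source[OF small])
  then have W: "ob (ultra_class U (\<lambda>i. objs (C i)) w) w"
    by (rule rep_class[OF rep_mor_nonempty(1)[OF F]])
  have "ultra_class U (\<lambda>i. mors (C i)) g = ultra_class U (\<lambda>i. mors (C i)) h"
    using mono gh[THEN arrow_in_homs[OF _ W ob_source[OF F]]]
      arrow_eqI[OF gh(1)[THEN arrow_cmp[OF _ rep_arrow[OF F]]] gh(2)[THEN arrow_cmp[OF _ rep_arrow[OF F]]] ev(3)]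
    unfolding is_mono_def by blast
  then have "\<forall>\<^sub>F i in U. g i = h i" by (simp add: rep_eq_iff[OF gh[THEN arrow_rep]])
  then show False using ev(4) by (simp add: eventually_not_iff[symmetric])
qed

lemma eventually_is_epi:
  assumes F: "mor F f" and epi: "is_epi UC F"
  shows "\<forall>\<^sub>F i in U. is_epi (C i) (f i)"
proof (rule ccontr)
  let ?t = "\<lambda>i. target (C i) (f i)"
  assume "\<not> (\<forall>\<^sub>F i in U. is_epi (C i) (f i))"
  then have "\<forall>\<^sub>F i in U. \<not> is_epi (C i) (f i)" by (simp add: eventually_not_iff)
  then have "\<forall>\<^sub>F i in U. \<exists>w g h. g \<in> homs (C i) (?t i) w \<and> h \<in> homs (C i) (?t i) w \<and>
      cmp (C i) g (f i) = cmp (C i) h (f i) \<and> g \<noteq> h"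
    using rep_eventually[OF F] by eventually_elim (unfold is_epi_def, blast)
  then obtain w g h where ev: "\<forall>\<^sub>F i in U. g i \<in> homs (C i) (?t i) (w i)"
    "\<forall>\<^sub>F i in U. h i \<in> homs (C i) (?t i) (w i)"
    "\<forall>\<^sub>F i in U. cmp (C i) (g i) (f i) = cmp (C i) (h i) (f i)" "\<forall>\<^sub>F i in U. g i \<noteq> h i"
    unfolding eventually_ex eventually_conj_iff by blast
  note gh = arrow_class[OF rep_mor_nonempty(1)[OF F] ev(1)] arrow_class[OF rep_mor_nonempty(1)[OF F] ev(2)]
  have "\<forall>\<^sub>F i in U. w i \<in> objs (C i)"
    using ev(1) by eventually_elim (rule small_category.homs_target[OF small])
  then have W: "ob (ultra_class U (\<lambda>i. objs (C i)) w) w"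
    by (rule rep_class[OF rep_mor_nonempty(1)[OF F]])
  have "ultra_class U (\<lambda>i. mors (C i)) g = ultra_class U (\<lambda>i. mors (C i)) h"
    using epi gh[THEN arrow_in_homs[OF _ ob_target[OF F] W]]
      arrow_eqI[OF gh(1)[THEN arrow_cmp[OF rep_arrow[OF F]]] gh(2)[THEN arrow_cmp[OF rep_arrow[OF F]]] ev(3)]
    unfolding is_epi_def by blast
  then have "\<forall>\<^sub>F i in U. g i = h i" by (simp add: rep_eq_iff[OF gh[THEN arrow_rep]])
  then show False using ev(4) by (simp add: eventually_not_iff[symmetric])
qed

end

context preadditive_category
begin

lemma zero_mor_closed: "X \<in> objs C \<Longrightarrow> Y \<in> objs C \<Longrightarrow> zero_mor A X Y \<in> homs C X Y"
  using comm_group.axioms(1)[OF hom_comm_group] comm_monoid.axioms(1)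
    monoid.one_closed[of "hom_group C A X Y"]
  by (auto simp: hom_group_def)

lemma
  assumes "f \<in> homs C X Y"
  shows add_mor_closed: "g \<in> homs C X Y \<Longrightarrow> f \<boxplus>\<^bsub>A\<^esub> g \<in> homs C X Y"
    and add_mor_assoc: "g \<in> homs C X Y \<Longrightarrow> h \<in> homs C X Y \<Longrightarrow>
      f \<boxplus>\<^bsub>A\<^esub> g \<boxplus>\<^bsub>A\<^esub> h = f \<boxplus>\<^bsub>A\<^esub> (g \<boxplus>\<^bsub>A\<^esub> h)"
    and add_mor_comm: "g \<in> homs C X Y \<Longrightarrow> f \<boxplus>\<^bsub>A\<^esub> g = g \<boxplus>\<^bsub>A\<^esub> f"
    and zero_add_mor: "zero_mor A X Y \<boxplus>\<^bsub>A\<^esub> f = f"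
    and ex_neg_mor: "\<exists>g\<in>homs C X Y. g \<boxplus>\<^bsub>A\<^esub> f = zero_mor A X Y"
proof -
  interpret G: comm_group "hom_group C A X Y"
    by (rule hom_comm_group[OF homs_source[OF assms] homs_target[OF assms]])
  show "g \<in> homs C X Y \<Longrightarrow> f \<boxplus>\<^bsub>A\<^esub> g \<in> homs C X Y"
    using G.m_closed[of f g] assms by (simp add: hom_group_def)
  show "g \<in> homs C X Y \<Longrightarrow> h \<in> homs C X Y \<Longrightarrow>
      f \<boxplus>\<^bsub>A\<^esub> g \<boxplus>\<^bsub>A\<^esub> h = f \<boxplus>\<^bsub>A\<^esub> (g \<boxplus>\<^bsub>A\<^esub> h)"
    using G.m_assoc[of f g h] assms by (simp add: hom_group_def)
  show "g \<in> homs C X Y \<Longrightarrow> f \<boxplus>\<^bsub>A\<^esub> g = g \<boxplus>\<^bsub>A\<^esub> f"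
    using G.m_comm[of f g] assms by (simp add: hom_group_def)
  show "zero_mor A X Y \<boxplus>\<^bsub>A\<^esub> f = f"
    using G.l_one[of f] assms by (simp add: hom_group_def)
  show "\<exists>g\<in>homs C X Y. g \<boxplus>\<^bsub>A\<^esub> f = zero_mor A X Y"
    using G.l_inv_ex[of f] assms by (simp add: hom_group_def)
qed

end

text \<open>A sequence of categories of which almost every one is preadditive. Empty factors are allowed: the
  ultraproduct then has no objects, and the axioms of preadditive and of linear categories hold
  vacuously.\<close>

locale preadditive_family = category_family U C
  for U :: "'i filter" and C :: "'i \<Rightarrow> ('o, 'm) category" +
  fixes A :: "'i \<Rightarrow> ('o, 'm) additive_data"
  assumes preadd: "\<forall>\<^sub>F i in U. preadditive_category (C i) (A i)"
begin

abbreviation UA where "UA \<equiv> ultra_additive U C A"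

lemma UA_simps:
  "add_mor UA = ulift2 U (\<lambda>i. mors (C i)) (\<lambda>i. add_mor (A i))"
  "zero_mor UA = ulift2 U (\<lambda>i. mors (C i)) (\<lambda>i. zero_mor (A i))"
  by (simp_all add: ultra_additive_def)

lemma arrow_add:
  assumes "arrow F f x y" "arrow G g x y"
  shows "arrow (add_mor UA F G) (\<lambda>i. add_mor (A i) (f i) (g i)) x y"
  unfolding UA_simps
  by (rule arrow_lift2[OF rep_mor_nonempty(1)[OF arrow_rep[OF assms(1)]] assms[THEN arrow_rep]],
      use preadd assms[THEN arrow_eventually] in eventually_elim, rule preadditive_category.add_mor_closed)

lemma arrow_zero:
  assumes "ob X x" "ob Y y"
  shows "arrow (zero_mor UA X Y) (\<lambda>i. zero_mor (A i) (x i) (y i)) x y"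
  unfolding UA_simps
  by (rule arrow_lift2[OF ob_nonempty(1)[OF assms(1)] assms],
      use preadd assms[THEN rep_eventually] in eventually_elim, rule preadditive_category.zero_mor_closed)

lemmas add_rules = arrow_cmp arrow_ident arrow_add arrow_zero

lemma comm_group_UC:
  assumes X: "X \<in> objs UC" and Y: "Y \<in> objs UC"
  shows "comm_group (hom_group UC UA X Y)"
proof (rule comm_groupI; simp add: hom_group_def)
  note XY = ob_some_rep[OF X] ob_some_rep[OF Y]
  show "add_mor UA F G \<in> homs UC X Y" if h: "F \<in> homs UC X Y" "G \<in> homs UC X Y" for F G
    by (rule arrow_in_homs[OF arrow_add[OF h[THEN arrow_some_rep]] XY])
  show "zero_mor UA X Y \<in> homs UC X Y"
    by (rule arrow_in_homs[OF arrow_zero[OF XY] XY])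
  show "add_mor UA (add_mor UA F G) H = add_mor UA F (add_mor UA G H)"
    if h: "F \<in> homs UC X Y" "G \<in> homs UC X Y" "H \<in> homs UC X Y" for F G H
    by (rule arrow_eqI, (rule add_rules h[THEN arrow_some_rep])+,
        use preadd h[THEN some_rep_homs] in eventually_elim,
        rule preadditive_category.add_mor_assoc)
  show "add_mor UA F G = add_mor UA G F" if h: "F \<in> homs UC X Y" "G \<in> homs UC X Y" for F G
    by (rule arrow_eqI, (rule add_rules h[THEN arrow_some_rep])+,
        use preadd h[THEN some_rep_homs] in eventually_elim,
        rule preadditive_category.add_mor_comm)
  show "add_mor UA (zero_mor UA X Y) F = F" if h: "F \<in> homs UC X Y" for F
    by (rule arrow_eqI, (rule add_rules XY h[THEN arrow_some_rep])+,
        use preadd h[THEN some_rep_homs] in eventually_elim,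
        rule preadditive_category.zero_add_mor)
  show "\<exists>G\<in>homs UC X Y. add_mor UA G F = zero_mor UA X Y" if h: "F \<in> homs UC X Y" for F
  proof -
    have "\<forall>\<^sub>F i in U. \<exists>g\<in>homs (C i) (some_rep X i) (some_rep Y i).
        add_mor (A i) g (some_rep F i) = zero_mor (A i) (some_rep X i) (some_rep Y i)"
      using preadd some_rep_homs[OF h] by eventually_elim (rule preadditive_category.ex_neg_mor)
    then obtain g where g: "\<forall>\<^sub>F i in U. g i \<in> homs (C i) (some_rep X i) (some_rep Y i)"
      "\<forall>\<^sub>F i in U. add_mor (A i) (g i) (some_rep F i) = zero_mor (A i) (some_rep X i) (some_rep Y i)"
      unfolding Bex_def eventually_ex eventually_conj_iff by blast
    note G = arrow_class[OF ob_nonempty(1)[OF XY(1)] g(1)]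
    show ?thesis
      using arrow_eqI[OF arrow_add[OF G arrow_some_rep[OF h]] arrow_zero[OF XY] g(2)] arrow_in_homs[OF G XY] by blast
  qed
qed

lemma preadditive_category_UC: "preadditive_category UC UA"
proof (intro preadditive_category.intro small_category_UC preadditive_category_axioms.intro)
  show "comm_group (hom_group UC UA X Y)" if "X \<in> objs UC" "Y \<in> objs UC" for X Y
    using that by (rule comm_group_UC)
  show "cmp UC G (add_mor UA F F') = add_mor UA (cmp UC G F) (cmp UC G F')"
    if h: "F \<in> homs UC X Y" "F' \<in> homs UC X Y" "G \<in> homs UC Y Z" for F F' G X Y Z
    by (rule arrow_eqI, (rule add_rules h[THEN arrow_some_rep])+,
        use preadd h[THEN some_rep_homs] in eventually_elim,
        rule preadditive_category.cmp_add_right)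
  show "cmp UC (add_mor UA G G') F = add_mor UA (cmp UC G F) (cmp UC G' F)"
    if h: "F \<in> homs UC X Y" "G \<in> homs UC Y Z" "G' \<in> homs UC Y Z" for F G G' X Y Z
    by (rule arrow_eqI, (rule add_rules h[THEN arrow_some_rep])+,
        use preadd h[THEN some_rep_homs] in eventually_elim,
        rule preadditive_category.cmp_add_left)
qed

lemma is_biproduct_UC:
  assumes X1: "X1 \<in> objs UC" and X2: "X2 \<in> objs UC"
    and bip: "\<forall>\<^sub>F i in U. \<exists>p i1 i2 p1 p2. is_biproduct (C i) (A i) (some_rep X1 i) (some_rep X2 i) p i1 i2 p1 p2"
  shows "\<exists>P I1 I2 P1 P2. is_biproduct UC UA X1 X2 P I1 I2 P1 P2"
proof -
  obtain p i1 i2 p1 p2 where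
    "\<forall>\<^sub>F i in U. is_biproduct (C i) (A i) (some_rep X1 i) (some_rep X2 i) (p i) (i1 i) (i2 i) (p1 i) (p2 i)"
    using bip unfolding eventually_ex by blast
  note ev = this[unfolded is_biproduct_def eventually_conj_iff]
  note X = ob_some_rep[OF X1] ob_some_rep[OF X2]
  note ne = ob_nonempty(1)[OF X(1)]
  have P: "ob (ultra_class U (\<lambda>i. objs (C i)) p) p"
    by (rule rep_class[OF ne]) (insert ev, elim conjE, assumption)
  have I1: "arrow (ultra_class U (\<lambda>i. mors (C i)) i1) i1 (some_rep X1) p"
    by (rule arrow_class[OF ne]) (insert ev, elim conjE, assumption)
  have I2: "arrow (ultra_class U (\<lambda>i. mors (C i)) i2) i2 (some_rep X2) p"
    by (rule arrow_class[OF ne]) (insert ev, elim conjE, assumption)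
  have P1: "arrow (ultra_class U (\<lambda>i. mors (C i)) p1) p1 p (some_rep X1)"
    by (rule arrow_class[OF ne]) (insert ev, elim conjE, assumption)
  have P2: "arrow (ultra_class U (\<lambda>i. mors (C i)) p2) p2 p (some_rep X2)"
    by (rule arrow_class[OF ne]) (insert ev, elim conjE, assumption)
  note rls = add_rules X P I1 I2 P1 P2
  show ?thesis
    unfolding is_biproduct_def
  proof (intro exI conjI)
    show "ultra_class U (\<lambda>i. objs (C i)) p \<in> objs UC" by (rule ob_in[OF P])
    show "ultra_class U (\<lambda>i. mors (C i)) i1 \<in> homs UC X1 (ultra_class U (\<lambda>i. objs (C i)) p)"
      by (rule arrow_in_homs; rule I1 X P)
    show "ultra_class U (\<lambda>i. mors (C i)) i2 \<in> homs UC X2 (ultra_class U (\<lambda>i. objs (C i)) p)"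
      by (rule arrow_in_homs; rule I2 X P)
    show "ultra_class U (\<lambda>i. mors (C i)) p1 \<in> homs UC (ultra_class U (\<lambda>i. objs (C i)) p) X1"
      by (rule arrow_in_homs; rule P1 X P)
    show "ultra_class U (\<lambda>i. mors (C i)) p2 \<in> homs UC (ultra_class U (\<lambda>i. objs (C i)) p) X2"
      by (rule arrow_in_homs; rule P2 X P)
  qed (rule arrow_eqI, (rule rls)+, insert ev, elim conjE, assumption)+
qed

lemma is_kernel_UC:
  assumes F: "mor F f" and K: "mor K k"
    and ker: "\<forall>\<^sub>F i in U. is_kernel (C i) (A i) (f i) (k i)"
  shows "is_kernel UC UA F K"
  unfolding is_kernel_def
proof (intro conjI ballI impI)
  let ?sf = "\<lambda>i. source (C i) (f i)" and ?tf = "\<lambda>i. target (C i) (f i)"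
    and ?sk = "\<lambda>i. source (C i) (k i)"
  have "\<forall>\<^sub>F i in U. k i \<in> homs (C i) (?sk i) (?sf i)"
    using ker by eventually_elim (simp add: is_kernel_def homs_def)
  \<comment> \<open>With the source of \<open>f\<close> as the target of \<open>k\<close>, which is true almost everywhere, the typing rule for
    composition applies.\<close>
  with K have K': "arrow K k ?sk ?sf" by (simp add: arrow_def)
  note F' = rep_arrow[OF F]
  note ob = ob_source[OF F] ob_target[OF F] ob_source[OF K]
  show "F \<in> mors UC" "K \<in> mors UC"
    using F K by (simp_all add: mors_UC rep_in_ultraprod)
  show "target UC K = source UC F"
    by (rule rep_eqI[OF ob_target[OF K] ob(1)], use ker in eventually_elim) (simp add: is_kernel_def)
  show "cmp UC F K = zero_mor UA (source UC K) (target UC F)"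
    by (rule arrow_eqI[OF arrow_cmp[OF K' F'] arrow_zero[OF ob(3,2)]], use ker in eventually_elim)
      (simp add: is_kernel_def)
  fix G assume "G \<in> mors UC"
  then have G: "mor G (some_rep G)" by (rule mor_some_rep)
  assume *: "target UC G = source UC F \<and> cmp UC F G = zero_mor UA (source UC G) (target UC F)"
  let ?sg = "\<lambda>i. source (C i) (some_rep G i)"
  have t: "\<forall>\<^sub>F i in U. target (C i) (some_rep G i) = ?sf i"
    using * by (simp add: rep_eq_iff[OF ob_target[OF G] ob(1)])
  then have "\<forall>\<^sub>F i in U. some_rep G i \<in> homs (C i) (?sg i) (?sf i)"
    using rep_eventually[OF G] by eventually_elim (simp add: homs_def)
  with G have G': "arrow G (some_rep G) ?sg ?sf" by (simp add: arrow_def)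
  have "\<forall>\<^sub>F i in U. cmp (C i) (f i) (some_rep G i) = zero_mor (A i) (?sg i) (?tf i)"
    using * rep_eq_iff[OF arrow_cmp[OF G' F', THEN arrow_rep] arrow_zero[OF ob_source[OF G] ob(2), THEN arrow_rep]]
    by simp
  then have "\<forall>\<^sub>F i in U. \<exists>!h. h \<in> homs (C i) (?sg i) (?sk i) \<and> cmp (C i) (k i) h = some_rep G i"
    using ker t rep_eventually[OF G] by eventually_elim (simp add: is_kernel_def)
  then show "\<exists>!H. H \<in> homs UC (source UC G) (source UC K) \<and> cmp UC K H = G"
    by (rule ex1_homs_UC[OF ob_source[OF G] ob(3), rotated]) (rule rep_eq_iff[OF arrow_cmp[OF _ K', THEN arrow_rep] G])
qed

lemma is_cokernel_UC:
  assumes F: "mor F f" and K: "mor K k"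
    and coker: "\<forall>\<^sub>F i in U. is_cokernel (C i) (A i) (f i) (k i)"
  shows "is_cokernel UC UA F K"
  unfolding is_cokernel_def
proof (intro conjI ballI impI)
  let ?sf = "\<lambda>i. source (C i) (f i)" and ?tf = "\<lambda>i. target (C i) (f i)"
    and ?tk = "\<lambda>i. target (C i) (k i)"
  have "\<forall>\<^sub>F i in U. k i \<in> homs (C i) (?tf i) (?tk i)"
    using coker by eventually_elim (simp add: is_cokernel_def homs_def)
  with K have K': "arrow K k ?tf ?tk" by (simp add: arrow_def)
  note F' = rep_arrow[OF F]
  note ob = ob_source[OF F] ob_target[OF F] ob_target[OF K]
  show "F \<in> mors UC" "K \<in> mors UC"
    using F K by (simp_all add: mors_UC rep_in_ultraprod)
  show "source UC K = target UC F"
    by (rule rep_eqI[OF ob_source[OF K] ob(2)], use coker in eventually_elim) (simp add: is_cokernel_def)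
  show "cmp UC K F = zero_mor UA (source UC F) (target UC K)"
    by (rule arrow_eqI[OF arrow_cmp[OF F' K'] arrow_zero[OF ob(1,3)]], use coker in eventually_elim)
      (simp add: is_cokernel_def)
  fix G assume "G \<in> mors UC"
  then have G: "mor G (some_rep G)" by (rule mor_some_rep)
  assume *: "source UC G = target UC F \<and> cmp UC G F = zero_mor UA (source UC F) (target UC G)"
  let ?tg = "\<lambda>i. target (C i) (some_rep G i)"
  have s: "\<forall>\<^sub>F i in U. source (C i) (some_rep G i) = ?tf i"
    using * by (simp add: rep_eq_iff[OF ob_source[OF G] ob(2)])
  then have "\<forall>\<^sub>F i in U. some_rep G i \<in> homs (C i) (?tf i) (?tg i)"
    using rep_eventually[OF G] by eventually_elim (simp add: homs_def)
  with G have G': "arrow G (some_rep G) ?tf ?tg" by (simp add: arrow_def)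
  have "\<forall>\<^sub>F i in U. cmp (C i) (some_rep G i) (f i) = zero_mor (A i) (?sf i) (?tg i)"
    using * rep_eq_iff[OF arrow_cmp[OF F' G', THEN arrow_rep] arrow_zero[OF ob(1) ob_target[OF G], THEN arrow_rep]]
    by simp
  then have "\<forall>\<^sub>F i in U. \<exists>!h. h \<in> homs (C i) (?tk i) (?tg i) \<and> cmp (C i) h (k i) = some_rep G i"
    using coker s rep_eventually[OF G] by eventually_elim (simp add: is_cokernel_def)
  then show "\<exists>!H. H \<in> homs UC (target UC K) (target UC G) \<and> cmp UC H K = G"
    by (rule ex1_homs_UC[OF ob(3) ob_target[OF G], rotated]) (rule rep_eq_iff[OF arrow_cmp[OF K', THEN arrow_rep] G])
qed

lemma additive_category_UC:
  assumes ne: "\<And>i. objs (C i) \<noteq> {}" and add: "\<forall>\<^sub>F i in U. additive_category (C i) (A i)"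
  shows "additive_category UC UA"
proof -
  interpret UC: preadditive_category UC UA by (rule preadditive_category_UC)
  show ?thesis
  proof
    have "\<forall>\<^sub>F i in U. \<exists>z. zero_object (C i) z"
      using add by eventually_elim (rule additive_category.ex_zero_object)
    then obtain z where z: "\<forall>\<^sub>F i in U. zero_object (C i) (z i)"
      unfolding eventually_ex by blast
    then have "\<forall>\<^sub>F i in U. z i \<in> objs (C i)" by eventually_elim (simp add: zero_object_def)
    then show "\<exists>Z. zero_object UC Z" using zero_object_UC[OF rep_class[OF ne] z] by blast
    show "\<exists>P I1 I2 P1 P2. is_biproduct UC UA X1 X2 P I1 I2 P1 P2"
      if h: "X1 \<in> objs UC" "X2 \<in> objs UC" for X1 X2
      by (rule is_biproduct_UC[OF h], use add h[THEN some_rep_objs] in eventually_elim,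
          rule additive_category.ex_biproduct)
  qed
qed

lemma abelian_category_UC:
  assumes ne: "\<And>i. objs (C i) \<noteq> {}" and ab: "\<forall>\<^sub>F i in U. abelian_category (C i) (A i)"
  shows "abelian_category UC UA"
proof -
  have "\<forall>\<^sub>F i in U. additive_category (C i) (A i)"
    using ab by eventually_elim (rule abelian_category.axioms)
  with ne interpret UC: additive_category UC UA by (rule additive_category_UC)
  have ne': "mors (C i) \<noteq> {}" for i using ne mors_nonempty_iff by blast
  show ?thesis
  proof
    fix F
    show "\<exists>K. is_kernel UC UA F K" if "F \<in> mors UC"
    proof -
      note F = mor_some_rep[OF that]
      have "\<forall>\<^sub>F i in U. \<exists>k. is_kernel (C i) (A i) (some_rep F i) k"
        using ab rep_eventually[OF F] by eventually_elim (rule abelian_category.ex_kernel)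
      then obtain k where k: "\<forall>\<^sub>F i in U. is_kernel (C i) (A i) (some_rep F i) (k i)"
        unfolding eventually_ex by blast
      then have "\<forall>\<^sub>F i in U. k i \<in> mors (C i)" by eventually_elim (simp add: is_kernel_def)
      then show ?thesis using is_kernel_UC[OF F rep_class[OF ne'] k] by blast
    qed
    show "\<exists>K. is_cokernel UC UA F K" if "F \<in> mors UC"
    proof -
      note F = mor_some_rep[OF that]
      have "\<forall>\<^sub>F i in U. \<exists>k. is_cokernel (C i) (A i) (some_rep F i) k"
        using ab rep_eventually[OF F] by eventually_elim (rule abelian_category.ex_cokernel)
      then obtain k where k: "\<forall>\<^sub>F i in U. is_cokernel (C i) (A i) (some_rep F i) (k i)"
        unfolding eventually_ex by blast
      then have "\<forall>\<^sub>F i in U. k i \<in> mors (C i)" by eventually_elim (simp add: is_cokernel_def)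
      then show ?thesis using is_cokernel_UC[OF F rep_class[OF ne'] k] by blast
    qed
    show "\<exists>G. is_kernel UC UA G F" if mono: "is_mono UC F"
    proof -
      have F: "mor F (some_rep F)" using mono by (simp add: is_mono_def mor_some_rep)
      have "\<forall>\<^sub>F i in U. \<exists>g. is_kernel (C i) (A i) g (some_rep F i)"
        using ab eventually_is_mono[OF F mono] by eventually_elim (rule abelian_category.mono_normal)
      then obtain g where g: "\<forall>\<^sub>F i in U. is_kernel (C i) (A i) (g i) (some_rep F i)"
        unfolding eventually_ex by blast
      then have "\<forall>\<^sub>F i in U. g i \<in> mors (C i)" by eventually_elim (simp add: is_kernel_def)
      then show ?thesis using is_kernel_UC[OF rep_class[OF ne'] F g] by blast
    qed
    show "\<exists>G. is_cokernel UC UA G F" if epi: "is_epi UC F"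
    proof -
      have F: "mor F (some_rep F)" using epi by (simp add: is_epi_def mor_some_rep)
      have "\<forall>\<^sub>F i in U. \<exists>g. is_cokernel (C i) (A i) g (some_rep F i)"
        using ab eventually_is_epi[OF F epi] by eventually_elim (rule abelian_category.epi_normal)
      then obtain g where g: "\<forall>\<^sub>F i in U. is_cokernel (C i) (A i) (g i) (some_rep F i)"
        unfolding eventually_ex by blast
      then have "\<forall>\<^sub>F i in U. g i \<in> mors (C i)" by eventually_elim (simp add: is_cokernel_def)
      then show ?thesis using is_cokernel_UC[OF rep_class[OF ne'] F g] by blast
    qed
  qed
qed

end

section \<open>Ultraproducts of fields and linear ultraproducts\<close>

text \<open>A sequence of nonempty ring structures of which almost every one is a field.\<close>

locale field_family = ultrafilter U
  for U :: "'i filter" +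
  fixes K :: "'i \<Rightarrow> 'k ring"
  assumes carrier_ne: "carrier (K i) \<noteq> {}"
    and fields: "\<forall>\<^sub>F i in U. field (K i)"
begin

abbreviation UK where "UK \<equiv> ultra_ring U K"

abbreviation scalar where "scalar \<equiv> rep U (\<lambda>i. carrier (K i))"

lemma crings: "\<forall>\<^sub>F i in U. cring (K i)"
  using fields by eventually_elim (simp add: field_def domain_def)

lemma UK_simps:
  "carrier UK = ultraprod U (\<lambda>i. carrier (K i))"
  "monoid.mult UK = ulift2 U (\<lambda>i. carrier (K i)) (\<lambda>i. monoid.mult (K i))"
  "one UK = ultra_class U (\<lambda>i. carrier (K i)) (\<lambda>i. one (K i))"
  "zero UK = ultra_class U (\<lambda>i. carrier (K i)) (\<lambda>i. zero (K i))"
  "add UK = ulift2 U (\<lambda>i. carrier (K i)) (\<lambda>i. add (K i))"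
  by (simp_all add: ultra_ring_def)

lemma scalar_in: "scalar X x \<Longrightarrow> X \<in> carrier UK"
  by (simp add: UK_simps rep_in_ultraprod)

lemma scalar_some_rep: "X \<in> carrier UK \<Longrightarrow> scalar X (some_rep X)"
  by (simp add: UK_simps rep_some_rep)

lemma some_rep_carrier: "X \<in> carrier UK \<Longrightarrow> \<forall>\<^sub>F i in U. some_rep X i \<in> carrier (K i)"
  by (rule rep_eventually[OF scalar_some_rep])

lemma scalar_mult:
  assumes "scalar X x" "scalar Y y"
  shows "scalar (X \<otimes>\<^bsub>UK\<^esub> Y) (\<lambda>i. x i \<otimes>\<^bsub>K i\<^esub> y i)"
  unfolding UK_simps
  by (rule rep_lift2[OF assms carrier_ne], use crings assms[THEN rep_eventually] in eventually_elim,
      rule cring.cring_simprules(5))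

lemma scalar_add:
  assumes "scalar X x" "scalar Y y"
  shows "scalar (X \<oplus>\<^bsub>UK\<^esub> Y) (\<lambda>i. x i \<oplus>\<^bsub>K i\<^esub> y i)"
  unfolding UK_simps
  by (rule rep_lift2[OF assms carrier_ne], use crings assms[THEN rep_eventually] in eventually_elim,
      rule cring.cring_simprules(1))

lemma scalar_one: "scalar \<one>\<^bsub>UK\<^esub> (\<lambda>i. \<one>\<^bsub>K i\<^esub>)"
  unfolding UK_simps
  by (rule rep_class[OF carrier_ne], use crings in eventually_elim, rule cring.cring_simprules(6))

lemma scalar_zero: "scalar \<zero>\<^bsub>UK\<^esub> (\<lambda>i. \<zero>\<^bsub>K i\<^esub>)"
  unfolding UK_simps
  by (rule rep_class[OF carrier_ne], use crings in eventually_elim, rule cring.cring_simprules(2))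

lemmas scalar_rules = scalar_mult scalar_add scalar_one scalar_zero

lemma scalar_choose:
  assumes "\<forall>\<^sub>F i in U. \<exists>y\<in>carrier (K i). P i y"
  obtains Y y where "scalar Y y" "\<forall>\<^sub>F i in U. P i (y i)"
proof -
  obtain y where y: "\<forall>\<^sub>F i in U. y i \<in> carrier (K i)" "\<forall>\<^sub>F i in U. P i (y i)"
    using assms unfolding Bex_def eventually_ex eventually_conj_iff by blast
  then show thesis using that rep_class[OF carrier_ne y(1)] by blast
qed

lemma cring_UK: "cring UK"
proof (intro cringI abelian_groupI comm_monoidI)
  show "X \<oplus>\<^bsub>UK\<^esub> Y \<in> carrier UK" "X \<otimes>\<^bsub>UK\<^esub> Y \<in> carrier UK"
    if h: "X \<in> carrier UK" "Y \<in> carrier UK" for X Y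
    by (rule scalar_in, rule scalar_rules; rule h[THEN scalar_some_rep])+
  show "\<zero>\<^bsub>UK\<^esub> \<in> carrier UK" "\<one>\<^bsub>UK\<^esub> \<in> carrier UK"
    by (rule scalar_in, rule scalar_rules)+
  show "X \<oplus>\<^bsub>UK\<^esub> Y \<oplus>\<^bsub>UK\<^esub> Z = X \<oplus>\<^bsub>UK\<^esub> (Y \<oplus>\<^bsub>UK\<^esub> Z)"
    "X \<otimes>\<^bsub>UK\<^esub> Y \<otimes>\<^bsub>UK\<^esub> Z = X \<otimes>\<^bsub>UK\<^esub> (Y \<otimes>\<^bsub>UK\<^esub> Z)"
    "(X \<oplus>\<^bsub>UK\<^esub> Y) \<otimes>\<^bsub>UK\<^esub> Z = X \<otimes>\<^bsub>UK\<^esub> Z \<oplus>\<^bsub>UK\<^esub> Y \<otimes>\<^bsub>UK\<^esub> Z"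
    if h: "X \<in> carrier UK" "Y \<in> carrier UK" "Z \<in> carrier UK" for X Y Z
    by (rule rep_eqI, (rule scalar_rules h[THEN scalar_some_rep])+,
        use crings h[THEN some_rep_carrier] in eventually_elim,
        rule cring.cring_simprules, assumption+)+
  show "X \<oplus>\<^bsub>UK\<^esub> Y = Y \<oplus>\<^bsub>UK\<^esub> X" "X \<otimes>\<^bsub>UK\<^esub> Y = Y \<otimes>\<^bsub>UK\<^esub> X"
    if h: "X \<in> carrier UK" "Y \<in> carrier UK" for X Y
    by (rule rep_eqI, (rule scalar_rules h[THEN scalar_some_rep])+,
        use crings h[THEN some_rep_carrier] in eventually_elim,
        rule cring.cring_simprules, assumption+)+
  show "\<zero>\<^bsub>UK\<^esub> \<oplus>\<^bsub>UK\<^esub> X = X" "\<one>\<^bsub>UK\<^esub> \<otimes>\<^bsub>UK\<^esub> X = X" if h: "X \<in> carrier UK" for X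
    by (rule rep_eqI, (rule scalar_rules h[THEN scalar_some_rep])+,
        use crings h[THEN some_rep_carrier] in eventually_elim,
        rule cring.cring_simprules, assumption+)+
  show "\<exists>Y\<in>carrier UK. Y \<oplus>\<^bsub>UK\<^esub> X = \<zero>\<^bsub>UK\<^esub>" if h: "X \<in> carrier UK" for X
  proof -
    have "\<forall>\<^sub>F i in U. \<exists>y\<in>carrier (K i). y \<oplus>\<^bsub>K i\<^esub> some_rep X i = \<zero>\<^bsub>K i\<^esub>"
      using crings some_rep_carrier[OF h]
    proof eventually_elim
      case (elim i)
      interpret cring "K i" by (rule elim)
      show ?case using l_neg[OF elim(2)] a_inv_closed[OF elim(2)] by blast
    qed
    then obtain Y y where Y: "scalar Y y" "\<forall>\<^sub>F i in U. y i \<oplus>\<^bsub>K i\<^esub> some_rep X i = \<zero>\<^bsub>K i\<^esub>"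
      by (rule scalar_choose)
    show ?thesis
      using rep_eqI[OF scalar_add[OF Y(1) scalar_some_rep[OF h]] scalar_zero Y(2)] scalar_in[OF Y(1)] by blast
  qed
qed

lemma field_UK: "field UK"
proof (rule cring.cring_fieldI2[OF cring_UK])
  show "\<zero>\<^bsub>UK\<^esub> \<noteq> \<one>\<^bsub>UK\<^esub>"
  proof
    assume "\<zero>\<^bsub>UK\<^esub> = \<one>\<^bsub>UK\<^esub>"
    then have "\<forall>\<^sub>F i in U. \<zero>\<^bsub>K i\<^esub> = \<one>\<^bsub>K i\<^esub>" by (simp add: rep_eq_iff[OF scalar_zero scalar_one])
    then have "\<forall>\<^sub>F i in U. False"
      using fields by eventually_elim (simp add: field_def domain_def domain_axioms_def)
    then show False using proper by (simp add: trivial_limit_def)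
  qed
  fix X assume h: "X \<in> carrier UK" and "X \<noteq> \<zero>\<^bsub>UK\<^esub>"
  then have "\<forall>\<^sub>F i in U. some_rep X i \<noteq> \<zero>\<^bsub>K i\<^esub>"
    by (simp add: rep_eq_iff[OF scalar_some_rep[OF h] scalar_zero] eventually_not_iff)
  then have "\<forall>\<^sub>F i in U. \<exists>y\<in>carrier (K i). some_rep X i \<otimes>\<^bsub>K i\<^esub> y = \<one>\<^bsub>K i\<^esub>"
    using fields some_rep_carrier[OF h]
  proof eventually_elim
    case (elim i)
    interpret field "K i" by (rule elim)
    show ?case using elim field_Units[symmetric] by (auto simp: Units_def)
  qed
  then obtain Y y where Y: "scalar Y y" "\<forall>\<^sub>F i in U. some_rep X i \<otimes>\<^bsub>K i\<^esub> y i = \<one>\<^bsub>K i\<^esub>"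
    by (rule scalar_choose)
  show "\<exists>Y\<in>carrier UK. X \<otimes>\<^bsub>UK\<^esub> Y = \<one>\<^bsub>UK\<^esub>"
    using rep_eqI[OF scalar_mult[OF scalar_some_rep[OF h] Y(1)] scalar_one Y(2)] scalar_in[OF Y(1)] by blast
qed

end

context linear_category
begin

lemma
  assumes a: "a \<in> carrier K" and f: "f \<in> homs C X Y"
  shows scal_closed: "scal a f \<in> homs C X Y"
    and scal_add_left: "b \<in> carrier K \<Longrightarrow> scal (a \<oplus>\<^bsub>K\<^esub> b) f = scal a f \<boxplus>\<^bsub>A\<^esub> scal b f"
    and scal_add_right: "g \<in> homs C X Y \<Longrightarrow> scal a (f \<boxplus>\<^bsub>A\<^esub> g) = scal a f \<boxplus>\<^bsub>A\<^esub> scal a g"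
    and scal_mult: "b \<in> carrier K \<Longrightarrow> scal (a \<otimes>\<^bsub>K\<^esub> b) f = scal a (scal b f)"
proof -
  interpret M: module K "hom_module C A scal X Y"
    by (rule hom_is_module[OF homs_source[OF f] homs_target[OF f]])
  show "scal a f \<in> homs C X Y"
    using M.smult_closed[of a f] a f by (simp add: hom_module_def)
  show "b \<in> carrier K \<Longrightarrow> scal (a \<oplus>\<^bsub>K\<^esub> b) f = scal a f \<boxplus>\<^bsub>A\<^esub> scal b f"
    using M.smult_l_distr[of a b f] a f by (simp add: hom_module_def)
  show "g \<in> homs C X Y \<Longrightarrow> scal a (f \<boxplus>\<^bsub>A\<^esub> g) = scal a f \<boxplus>\<^bsub>A\<^esub> scal a g"
    using M.smult_r_distr[of a f g] a f by (simp add: hom_module_def)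
  show "b \<in> carrier K \<Longrightarrow> scal (a \<otimes>\<^bsub>K\<^esub> b) f = scal a (scal b f)"
    using M.smult_assoc1[of a b f] a f by (simp add: hom_module_def)
qed

lemma scal_one:
  assumes f: "f \<in> homs C X Y" shows "scal \<one>\<^bsub>K\<^esub> f = f"
  using module.smult_one[OF hom_is_module[OF homs_source[OF f] homs_target[OF f]], of f] f
  by (simp add: hom_module_def)

end

text \<open>A sequence of categories of which almost every one is linear over the field with the same index.\<close>

locale linear_family = preadditive_family U C A + field_family U K
  for U :: "'i filter" and C :: "'i \<Rightarrow> ('o, 'm) category" and A :: "'i \<Rightarrow> ('o, 'm) additive_data"
    and K :: "'i \<Rightarrow> 'k ring" +
  fixes s :: "'i \<Rightarrow> 'k \<Rightarrow> 'm \<Rightarrow> 'm"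
  assumes linear: "\<forall>\<^sub>F i in U. linear_category (C i) (A i) (K i) (s i)"
begin

abbreviation Us where "Us \<equiv> ultra_scal U C s"

lemma arrow_scal:
  assumes "scalar R r" "arrow F f x y"
  shows "arrow (Us R F) (\<lambda>i. s i (r i) (f i)) x y"
  unfolding ultra_scal_def
  by (rule arrow_lift2[OF rep_mor_nonempty(1)[OF arrow_rep[OF assms(2)]] assms(1) arrow_rep[OF assms(2)]],
      use linear rep_eventually[OF assms(1)] arrow_eventually[OF assms(2)] in eventually_elim,
      rule linear_category.scal_closed)

lemmas linear_rules = add_rules arrow_scal scalar_rules

lemma module_UC:
  assumes X: "X \<in> objs UC" and Y: "Y \<in> objs UC"
  shows "module UK (hom_module UC UA Us X Y)"
proof (rule moduleI)
  interpret UC: preadditive_category UC UA by (rule preadditive_category_UC)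
  show "cring UK" by (rule cring_UK)
  show "abelian_group (hom_module UC UA Us X Y)"
    by (rule abelian_groupI; simp add: hom_module_def)
      (rule UC.zero_mor_closed[OF X Y] |
        rule UC.add_mor_closed UC.add_mor_assoc UC.add_mor_comm UC.zero_add_mor UC.ex_neg_mor,
        assumption+)+
  note XY = ob_some_rep[OF X] ob_some_rep[OF Y]
  show "R \<odot>\<^bsub>hom_module UC UA Us X Y\<^esub> F \<in> carrier (hom_module UC UA Us X Y)"
    if "R \<in> carrier UK" "F \<in> carrier (hom_module UC UA Us X Y)" for R F
    using that arrow_in_homs[OF arrow_scal[OF scalar_some_rep arrow_some_rep] XY] by (simp add: hom_module_def)
  have "Us (R \<oplus>\<^bsub>UK\<^esub> S) F = add_mor UA (Us R F) (Us S F)"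
    if h: "R \<in> carrier UK" "S \<in> carrier UK" "F \<in> homs UC X Y" for R S F
    by (rule arrow_eqI, (rule linear_rules h(1,2)[THEN scalar_some_rep] arrow_some_rep[OF h(3)])+,
        use linear h(1,2)[THEN some_rep_carrier] some_rep_homs[OF h(3)] in eventually_elim,
        rule linear_category.scal_add_left)
  then show "(R \<oplus>\<^bsub>UK\<^esub> S) \<odot>\<^bsub>hom_module UC UA Us X Y\<^esub> F =
      R \<odot>\<^bsub>hom_module UC UA Us X Y\<^esub> F \<oplus>\<^bsub>hom_module UC UA Us X Y\<^esub>
      S \<odot>\<^bsub>hom_module UC UA Us X Y\<^esub> F"
    if "R \<in> carrier UK" "S \<in> carrier UK" "F \<in> carrier (hom_module UC UA Us X Y)" for R S F
    using that by (simp add: hom_module_def)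
  have "Us R (add_mor UA F G) = add_mor UA (Us R F) (Us R G)"
    if h: "R \<in> carrier UK" "F \<in> homs UC X Y" "G \<in> homs UC X Y" for R F G
    by (rule arrow_eqI, (rule linear_rules scalar_some_rep[OF h(1)] h(2,3)[THEN arrow_some_rep])+,
        use linear some_rep_carrier[OF h(1)] h(2,3)[THEN some_rep_homs] in eventually_elim,
        rule linear_category.scal_add_right)
  then show "R \<odot>\<^bsub>hom_module UC UA Us X Y\<^esub> (F \<oplus>\<^bsub>hom_module UC UA Us X Y\<^esub> G) =
      R \<odot>\<^bsub>hom_module UC UA Us X Y\<^esub> F \<oplus>\<^bsub>hom_module UC UA Us X Y\<^esub>
      R \<odot>\<^bsub>hom_module UC UA Us X Y\<^esub> G"
    if "R \<in> carrier UK" "F \<in> carrier (hom_module UC UA Us X Y)"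
      "G \<in> carrier (hom_module UC UA Us X Y)" for R F G
    using that by (simp add: hom_module_def)
  have "Us (R \<otimes>\<^bsub>UK\<^esub> S) F = Us R (Us S F)"
    if h: "R \<in> carrier UK" "S \<in> carrier UK" "F \<in> homs UC X Y" for R S F
    by (rule arrow_eqI, (rule linear_rules h(1,2)[THEN scalar_some_rep] arrow_some_rep[OF h(3)])+,
        use linear h(1,2)[THEN some_rep_carrier] some_rep_homs[OF h(3)] in eventually_elim,
        rule linear_category.scal_mult)
  then show "(R \<otimes>\<^bsub>UK\<^esub> S) \<odot>\<^bsub>hom_module UC UA Us X Y\<^esub> F =
      R \<odot>\<^bsub>hom_module UC UA Us X Y\<^esub> (S \<odot>\<^bsub>hom_module UC UA Us X Y\<^esub> F)"
    if "R \<in> carrier UK" "S \<in> carrier UK" "F \<in> carrier (hom_module UC UA Us X Y)" for R S F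
    using that by (simp add: hom_module_def)
  have "Us \<one>\<^bsub>UK\<^esub> F = F" if h: "F \<in> homs UC X Y" for F
    by (rule arrow_eqI, (rule linear_rules arrow_some_rep[OF h])+,
        use linear some_rep_homs[OF h] in eventually_elim, rule linear_category.scal_one)
  then show "\<one>\<^bsub>UK\<^esub> \<odot>\<^bsub>hom_module UC UA Us X Y\<^esub> F = F"
    if "F \<in> carrier (hom_module UC UA Us X Y)" for F
    using that by (simp add: hom_module_def)
qed

lemma linear_category_UC: "linear_category UC UA UK Us"
proof (intro linear_category.intro preadditive_category_UC linear_category_axioms.intro)
  show "module UK (hom_module UC UA Us X Y)" if "X \<in> objs UC" "Y \<in> objs UC" for X Y
    using that by (rule module_UC)
  show "cmp UC G (Us R F) = Us R (cmp UC G F)" "cmp UC (Us R G) F = Us R (cmp UC G F)"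
    if h: "R \<in> carrier UK" "F \<in> homs UC X Y" "G \<in> homs UC Y Z" for R F G X Y Z
    by (rule arrow_eqI, (rule linear_rules scalar_some_rep[OF h(1)] h(2,3)[THEN arrow_some_rep])+,
        use linear some_rep_carrier[OF h(1)] h(2,3)[THEN some_rep_homs] in eventually_elim,
        rule linear_category.cmp_scal_right linear_category.cmp_scal_left; assumption)+
qed

end

section \<open>The ultraproduct theorem\<close>

theorem theoremA22:
  fixes U :: "nat filter"
    and C :: "nat \<Rightarrow> ('o, 'm) category"
  assumes "ultrafilter U"
    and "\<And>i. small_category (C i)"
  shows
    "small_category (ultra_cat U C) \<and>
     equiv (\<Pi> i\<in>UNIV. objs (C i)) (ultra_rel U (\<lambda>i. objs (C i))) \<and>
     equiv (\<Pi> i\<in>UNIV. mors (C i)) (ultra_rel U (\<lambda>i. mors (C i))) \<and>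
     objs (ultra_cat U C) = (\<Pi> i\<in>UNIV. objs (C i)) // ultra_rel U (\<lambda>i. objs (C i)) \<and>
     mors (ultra_cat U C) = (\<Pi> i\<in>UNIV. mors (C i)) // ultra_rel U (\<lambda>i. mors (C i)) \<and>
     (\<forall>f\<in>(\<Pi> i\<in>UNIV. mors (C i)).
        source (ultra_cat U C) (ultra_class U (\<lambda>i. mors (C i)) f) =
          ultra_class U (\<lambda>i. objs (C i)) (\<lambda>i. source (C i) (f i)) \<and>
        target (ultra_cat U C) (ultra_class U (\<lambda>i. mors (C i)) f) =
          ultra_class U (\<lambda>i. objs (C i)) (\<lambda>i. target (C i) (f i))) \<and>
     (\<forall>X\<in>(\<Pi> i\<in>UNIV. objs (C i)).
        ident (ultra_cat U C) (ultra_class U (\<lambda>i. objs (C i)) X) =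
          ultra_class U (\<lambda>i. mors (C i)) (\<lambda>i. ident (C i) (X i))) \<and>
     (\<forall>f\<in>(\<Pi> i\<in>UNIV. mors (C i)). \<forall>g\<in>(\<Pi> i\<in>UNIV. mors (C i)).
        target (ultra_cat U C) (ultra_class U (\<lambda>i. mors (C i)) f) =
          source (ultra_cat U C) (ultra_class U (\<lambda>i. mors (C i)) g) \<longrightarrow>
        cmp (ultra_cat U C) (ultra_class U (\<lambda>i. mors (C i)) g) (ultra_class U (\<lambda>i. mors (C i)) f) =
          ultra_class U (\<lambda>i. mors (C i)) (\<lambda>i. cmp (C i) (g i) (f i))) \<and>
     ((\<forall>\<^sub>F i in U. idempotent_complete (C i)) \<longrightarrow> idempotent_complete (ultra_cat U C)) \<and>
     (\<forall>(K :: nat \<Rightarrow> 'k ring) A s.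
        (\<forall>i. carrier (K i) \<noteq> {}) \<and>
        (\<forall>\<^sub>F i in U. field (K i) \<and> linear_category (C i) (A i) (K i) (s i)) \<longrightarrow>
        field (ultra_ring U K) \<and>
        linear_category (ultra_cat U C) (ultra_additive U C A) (ultra_ring U K)
          (ultra_scal U C s)) \<and>
     ((\<forall>i. objs (C i) \<noteq> {}) \<longrightarrow>
       (\<forall>M. (\<forall>\<^sub>F i in U. monoidal_category (C i) (M i)) \<longrightarrow>
          monoidal_category (ultra_cat U C) (ultra_monoidal U C M)) \<and>
       (\<forall>M. (\<forall>\<^sub>F i in U. rigid_category (C i) (M i)) \<longrightarrow>
          rigid_category (ultra_cat U C) (ultra_monoidal U C M)) \<and>
       (\<forall>M X Y ev coev.
          (\<forall>\<^sub>F i in U. monoidal_category (C i) (M i) \<and>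
             is_dual (C i) (M i) (X i) (Y i) (ev i) (coev i)) \<longrightarrow>
          is_dual (ultra_cat U C) (ultra_monoidal U C M)
            (ultra_class U (\<lambda>i. objs (C i)) X) (ultra_class U (\<lambda>i. objs (C i)) Y)
            (ultra_class U (\<lambda>i. mors (C i)) ev) (ultra_class U (\<lambda>i. mors (C i)) coev)) \<and>
       (\<forall>M c. (\<forall>\<^sub>F i in U. braided_category (C i) (M i) (c i)) \<longrightarrow>
          braided_category (ultra_cat U C) (ultra_monoidal U C M) (ultra_braid U C c)) \<and>
       (\<forall>M c. (\<forall>\<^sub>F i in U. symmetric_category (C i) (M i) (c i)) \<longrightarrow>
          symmetric_category (ultra_cat U C) (ultra_monoidal U C M) (ultra_braid U C c)) \<and>
       (\<forall>A. (\<forall>\<^sub>F i in U. additive_category (C i) (A i)) \<longrightarrow>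
          additive_category (ultra_cat U C) (ultra_additive U C A)) \<and>
       (\<forall>A. (\<forall>\<^sub>F i in U. abelian_category (C i) (A i)) \<longrightarrow>
          abelian_category (ultra_cat U C) (ultra_additive U C A)))"
proof -
  interpret category_family U C
    using assms by (intro category_family.intro category_family_axioms.intro)
  have mor_class: "mor (ultra_class U (\<lambda>i. mors (C i)) f) f" if "f \<in> (\<Pi> i\<in>UNIV. mors (C i))" for f
    using that by (intro rep_class) (auto simp: Pi_iff)
  have ob_class: "ob (ultra_class U (\<lambda>i. objs (C i)) X) X" if "X \<in> (\<Pi> i\<in>UNIV. objs (C i))" for X
    using that by (intro rep_class) (auto simp: Pi_iff)
  have source_target:
    "source UC (ultra_class U (\<lambda>i. mors (C i)) f) =
      ultra_class U (\<lambda>i. objs (C i)) (\<lambda>i. source (C i) (f i)) \<and>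
     target UC (ultra_class U (\<lambda>i. mors (C i)) f) =
      ultra_class U (\<lambda>i. objs (C i)) (\<lambda>i. target (C i) (f i))"
    if "f \<in> (\<Pi> i\<in>UNIV. mors (C i))" for f
    using ob_source[OF mor_class[OF that]] ob_target[OF mor_class[OF that]] by (simp add: rep_def)
  have ident: "ident UC (ultra_class U (\<lambda>i. objs (C i)) X) =
      ultra_class U (\<lambda>i. mors (C i)) (\<lambda>i. ident (C i) (X i))"
    if "X \<in> (\<Pi> i\<in>UNIV. objs (C i))" for X
    using arrow_rep[OF arrow_ident[OF ob_class[OF that]]] by (simp add: rep_def)
  have cmp: "cmp UC (ultra_class U (\<lambda>i. mors (C i)) g) (ultra_class U (\<lambda>i. mors (C i)) f) =
      ultra_class U (\<lambda>i. mors (C i)) (\<lambda>i. cmp (C i) (g i) (f i))"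
    if f: "f \<in> (\<Pi> i\<in>UNIV. mors (C i))" and g: "g \<in> (\<Pi> i\<in>UNIV. mors (C i))"
      and eq: "target UC (ultra_class U (\<lambda>i. mors (C i)) f) =
        source UC (ultra_class U (\<lambda>i. mors (C i)) g)" for f g
  proof -
    \<comment> \<open>Equality of classes only makes the representatives composable at almost every index.\<close>
    have "\<forall>\<^sub>F i in U. target (C i) (f i) = source (C i) (g i)"
      using eq by (simp add: rep_eq_iff[OF ob_target[OF mor_class[OF f]] ob_source[OF mor_class[OF g]]])
    then have "\<forall>\<^sub>F i in U. f i \<in> homs (C i) (source (C i) (f i)) (source (C i) (g i))"
      using rep_eventually[OF mor_class[OF f]] by eventually_elim (simp add: homs_def)
    then have "arrow (ultra_class U (\<lambda>i. mors (C i)) f) f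
        (\<lambda>i. source (C i) (f i)) (\<lambda>i. source (C i) (g i))"
      using mor_class[OF f] by (simp add: arrow_def)
    from arrow_rep[OF arrow_cmp[OF this rep_arrow[OF mor_class[OF g]]]] show ?thesis
      by (simp add: rep_def)
  qed
  have linear: "field (ultra_ring U K) \<and>
      linear_category UC (ultra_additive U C A) (ultra_ring U K) (ultra_scal U C s)"
    if ne: "\<forall>i. carrier (K i) \<noteq> {}"
      and lin: "\<forall>\<^sub>F i in U. field (K i) \<and> linear_category (C i) (A i) (K i) (s i)"
    for K :: "nat \<Rightarrow> 'k ring" and A s
  proof -
    note lin = lin[unfolded eventually_conj_iff]
    have pre: "\<forall>\<^sub>F i in U. preadditive_category (C i) (A i)"
      using conjunct2[OF lin] by eventually_elim (rule linear_category.axioms)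
    interpret linear_family U C A K s
      by unfold_locales (use ne pre lin in auto)
    show ?thesis using field_UK linear_category_UC by blast
  qed
  have monoidal: "monoidal_family U C M"
    if "\<forall>i. objs (C i) \<noteq> {}" "\<forall>\<^sub>F i in U. monoidal_category (C i) (M i)" for M
    using that by unfold_locales auto
  have braided: "braided_family U C M c"
    if ne: "\<forall>i. objs (C i) \<noteq> {}" and br: "\<forall>\<^sub>F i in U. braided_category (C i) (M i) (c i)" for M c
  proof -
    have "\<forall>\<^sub>F i in U. monoidal_category (C i) (M i)"
      using br by eventually_elim (rule braided_category.axioms)
    then show ?thesis
      using monoidal[OF ne] br by (intro braided_family.intro braided_family_axioms.intro)
  qed
  have rigid: "rigid_category UC (ultra_monoidal U C M)"
    if ne: "\<forall>i. objs (C i) \<noteq> {}" and rig: "\<forall>\<^sub>F i in U. rigid_category (C i) (M i)" for M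
  proof -
    have "\<forall>\<^sub>F i in U. monoidal_category (C i) (M i)"
      using rig by eventually_elim (rule rigid_category.axioms)
    from monoidal_family.rigid_category_UC[OF monoidal[OF ne this] rig] show ?thesis .
  qed
  have dual: "is_dual UC (ultra_monoidal U C M)
      (ultra_class U (\<lambda>i. objs (C i)) X) (ultra_class U (\<lambda>i. objs (C i)) Y)
      (ultra_class U (\<lambda>i. mors (C i)) ev) (ultra_class U (\<lambda>i. mors (C i)) coev)"
    if ne: "\<forall>i. objs (C i) \<noteq> {}" and d: "\<forall>\<^sub>F i in U. monoidal_category (C i) (M i) \<and>
        is_dual (C i) (M i) (X i) (Y i) (ev i) (coev i)" for M X Y ev coev
    using d monoidal_family.is_dual_class[OF monoidal[OF ne]] by (simp add: eventually_conj_iff)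
  have symmetric: "symmetric_category UC (ultra_monoidal U C M) (ultra_braid U C c)"
    if ne: "\<forall>i. objs (C i) \<noteq> {}" and sym: "\<forall>\<^sub>F i in U. symmetric_category (C i) (M i) (c i)" for M c
  proof -
    have "\<forall>\<^sub>F i in U. braided_category (C i) (M i) (c i)"
      using sym by eventually_elim (rule symmetric_category.axioms)
    from braided_family.symmetric_category_UC[OF braided[OF ne this] sym] show ?thesis .
  qed
  have additive: "additive_category UC (ultra_additive U C A)"
    if ne: "\<forall>i. objs (C i) \<noteq> {}" and add: "\<forall>\<^sub>F i in U. additive_category (C i) (A i)" for A
  proof -
    have pre: "\<forall>\<^sub>F i in U. preadditive_category (C i) (A i)"
      using add by eventually_elim (rule additive_category.axioms)
    interpret preadditive_family U C A by unfold_locales (rule pre)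
    show ?thesis using ne add by (intro additive_category_UC) auto
  qed
  have abelian: "abelian_category UC (ultra_additive U C A)"
    if ne: "\<forall>i. objs (C i) \<noteq> {}" and ab: "\<forall>\<^sub>F i in U. abelian_category (C i) (A i)" for A
  proof -
    have pre: "\<forall>\<^sub>F i in U. preadditive_category (C i) (A i)"
      using ab by eventually_elim (rule additive_category.axioms[OF abelian_category.axioms(1)])
    interpret preadditive_family U C A by unfold_locales (rule pre)
    show ?thesis using ne ab by (intro abelian_category_UC) auto
  qed
  show ?thesis
  proof (intro conjI allI impI ballI)
    show "objs UC = (\<Pi> i\<in>UNIV. objs (C i)) // ultra_rel U (\<lambda>i. objs (C i))"
      "mors UC = (\<Pi> i\<in>UNIV. mors (C i)) // ultra_rel U (\<lambda>i. mors (C i))"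
      by (simp_all add: ultra_cat_def ultraprod_def)
  qed (fact small_category_UC equiv_ultra_rel |
      erule source_target[THEN conjunct1] source_target[THEN conjunct2] ident |
      rule cmp, assumption+ |
      rule linear[THEN conjunct1] linear[THEN conjunct2], (erule conjunct1 conjunct2)+ |
      rule monoidal_family.monoidal_category_UC[OF monoidal] rigid dual
        braided_family.braided_category_UC[OF braided] symmetric additive abelian, assumption+ |
      rule idempotent_complete_UC, assumption)+
qed

end
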